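(* For any $0 < \epsilon < 1$, there exists a constant $c > 0$ (depending on $\epsilon$) such that the following is true. Let $A$ be an $n \times n$ real symmetric matrix of trace equal to one, and let $D = \{X \in \mathbf{S}^n : X \succeq 0,\ \operatorname{Tr}(X) = 1\}$. If $P$ is a polytope such that $$(1-\epsilon)(D - A) \subset P \subset D - A,$$ then the extension complexity of $P$ is at least $e^{c\sqrt{n}}$.
   Context: $\mathbf{S}^n$ denotes the real vector space of $n \times n$ real symmetric matrices, and $X \succeq 0$ means that $X$ is positive semidefinite. For a set $S \subset \mathbf{S}^n$, a matrix $A \in \mathbf{S}^n$ and a scalar $t$, $S - A = \{X - A : X \in S\}$ and $tS = \{tX : X \in S\}$. A polytope is the convex hull of finitely many points. The extension complexity of a polytope $P$ is the smallest integer $k$ such that $P$ can be expressed as the linear image of a polytope with $k$ facets.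
   Formalization: The formal theorem assumes n ≥ 2: for n = 1, D − A = {0} forces P = {0}, a point with no facets and extension complexity 0, so the claimed bound e^{c√n} fails there; for n = 0 no A has trace one. *)

theory Defs
  imports "HOL-Analysis.Analysis" "HOL-Analysis.Finite_Function_Topology"
begin

section \<open>Facets and extension complexity\<close>

text \<open>
  The library's \<^const>\<open>aff_dim\<close> and \<^const>\<open>facet_of\<close> are restricted to the class
  \<^class>\<open>euclidean_space\<close>, where the dimension is determined by the type. Here the ambient
  dimension is a number that is quantified over, so \<open>\<real>\<^sup>m\<close> is represented as a subspace of
  \<^typ>\<open>(nat, real) poly_mapping\<close>. The two definitions below repeat the library's ones
  for an arbitrary real vector space. They are only meaningful for sets with a
  finite-dimensional affine hull, such as polytopes and their faces.
\<close>

definition affine_dim :: "'a::real_vector set \<Rightarrow> int" where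
  "affine_dim V = (SOME d :: int.
     \<exists>B. affine hull B = affine hull V \<and> \<not> affine_dependent B \<and> of_nat (card B) = d + 1)"

definition facets :: "'a::real_vector set \<Rightarrow> 'a set set" where
  "facets S = {F. F face_of S \<and> F \<noteq> {} \<and> affine_dim F = affine_dim S - 1}"

lemma affine_dim_eq_aff_dim: "affine_dim V = aff_dim V"
  by (simp add: affine_dim_def aff_dim_def)

lemma facets_eq_facet_of: "facets S = {F. F facet_of S}"
  by (simp add: facets_def facet_of_def affine_dim_eq_aff_dim)

definition coord_space :: "nat \<Rightarrow> (nat, real) poly_mapping set" where
  "coord_space m = {x. Poly_Mapping.keys x \<subseteq> {..<m}}"

text \<open>
  A linear map on \<open>\<real>\<^sup>m\<close> is given as the restriction of a linear map on all of
  \<^typ>\<open>(nat, real) poly_mapping\<close>; every linear map on a subspace extends to the whole space.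
\<close>

definition extension_complexity :: "'a::real_vector set \<Rightarrow> nat" where
  "extension_complexity P =
     (LEAST k. \<exists>m Q (f :: (nat, real) poly_mapping \<Rightarrow> 'a).
        Q \<subseteq> coord_space m \<and> polytope Q \<and> card (facets Q) = k \<and> linear f \<and> P = f ` Q)"


section \<open>Symmetric matrices\<close>

text \<open>
  An \<open>n \<times> n\<close> matrix is a finitely supported function on pairs of indices that vanishes outside
  \<open>{..<n} \<times> {..<n}\<close>, so that matrices of all sizes live in one real vector space.
\<close>

type_synonym rmat = "(nat \<times> nat, real) poly_mapping"

definition sym_mats :: "nat \<Rightarrow> rmat set" where
  "sym_mats n = {X. Poly_Mapping.keys X \<subseteq> {..<n} \<times> {..<n} \<and>
     (\<forall>i j. Poly_Mapping.lookup X (i, j) = Poly_Mapping.lookup X (j, i))}"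

definition mat_trace :: "nat \<Rightarrow> rmat \<Rightarrow> real" where
  "mat_trace n X = (\<Sum>i<n. Poly_Mapping.lookup X (i, i))"

definition psd :: "nat \<Rightarrow> rmat \<Rightarrow> bool" where
  "psd n X \<longleftrightarrow>
     (\<forall>v :: nat \<Rightarrow> real. 0 \<le> (\<Sum>i<n. \<Sum>j<n. v i * Poly_Mapping.lookup X (i, j) * v j))"

definition spectraplex :: "nat \<Rightarrow> rmat set" where
  "spectraplex n = {X \<in> sym_mats n. psd n X \<and> mat_trace n X = 1}"

definition translate_by :: "'a::real_vector set \<Rightarrow> 'a \<Rightarrow> 'a set" where
  "translate_by S A = {X - A | X. X \<in> S}"

definition dilate :: "real \<Rightarrow> 'a::real_vector set \<Rightarrow> 'a set" where
  "dilate t S = {t *\<^sub>R X | X. X \<in> S}"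


section \<open>The case of a single point\<close>

text \<open>
  For \<open>n = 1\<close> the set \<^term>\<open>spectraplex n\<close> is a single point. A point has no facets, so its
  extension complexity is \<open>0\<close>, and no bound of the form \<open>exp (c * sqrt n)\<close> can hold. The main
  statement is therefore made for \<open>n \<ge> 2\<close>.
\<close>

lemma extension_complexity_zero: "extension_complexity {0} = 0"
proof -
  have "facets {0 :: (nat, real) poly_mapping} = {}"
    by (auto simp: facets_def dest!: face_of_imp_subset subset_singletonD)
  moreover have "polytope {0 :: (nat, real) poly_mapping}"
    unfolding polytope_def by (metis convex_hull_singleton finite.emptyI finite.insertI)
  ultimately show ?thesis
    unfolding extension_complexity_def
    by (intro Least_eq_0 exI[of _ 0] exI[of _ "{0}"] exI[of _ "\<lambda>_. 0"])
       (auto simp: coord_space_def module_hom_zero)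
qed

end

theory Submission
  imports Defs
begin

text \<open>
  Write \<open>P\<close> as the image \<open>f ` Q\<close> of a polytope \<open>Q\<close> with \<open>k\<close> facets, and test \<open>P\<close> against two
  finite families indexed by the cube \<open>{-1, 1}\<^sup>n\<close>. On one side are the points
  \<open>(1 - \<epsilon>) (x x\<^sup>T / n - A)\<close>, which lie in \<open>P\<close> by the inner inclusion; on the other are the
  functionals \<open>X \<mapsto> y\<^sup>T (X + A) y\<close>, which are nonnegative on \<open>P\<close> by the outer inclusion. Their values
  form the slack matrix \<open>S(x, y) = (1 - \<epsilon>) \<langle>x, y\<rangle>\<^sup>2 / n + \<epsilon> y\<^sup>T A y\<close>.

  As in Yannakakis' theorem, \<open>Q\<close> factors this matrix: every affine functional that is nonnegative on
  \<open>Q\<close> is a nonnegative combination of one functional per facet plus a nonnegative constant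
  (\<open>nonneg_functional_facet_combination\<close>), so \<open>S(x, y) = (\<Sum>i\<in>I. a i x * b i y)\<close> with nonnegative
  \<open>a\<close>, \<open>b\<close> and only \<open>k + 1\<close> terms.

  Such a factorization needs many terms. The matrix has mean \<open>1\<close> and entries at most \<open>n\<close>, the latter
  because \<open>S(x, y)\<close> is the value at \<open>y\<close> of the quadratic form of a positive semidefinite matrix of
  trace \<open>1\<close>. Its mean correlation over the cube with the kernel
  \<open>(\<Sum>p<q. x p * x q * y p * y q)\<close> is \<open>(1 - \<epsilon>) (n - 1)\<close>, linear in \<open>n\<close> and
  independent of \<open>A\<close>. A single term \<open>a x * b y\<close>, however, correlates with the kernel by at most the
  product of the degree-two Fourier norms of \<open>a\<close> and \<open>b\<close>, and a nonnegative function whose maximum is at most \<open>e\<^sup>2\<^sup>m\<close>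
  times its mean has degree-two norm \<open>O(m)\<close> times its mean (\<open>level_two_inequality\<close>). This last fact
  is where hypercontractivity enters: the \<open>2m\<close>-th moment of a quadratic form in random signs is at
  most \<open>(2m)\<^sup>2\<^sup>m\<close> times the \<open>m\<close>-th power of its second moment. If \<open>(k + 1) n \<le> e\<^sup>2\<^sup>m\<close>, the terms
  together contribute only \<open>O(m\<^sup>2)\<close>, so that \<open>(1 - \<epsilon>) (n - 1) = O(m\<^sup>2)\<close>. Taking \<open>m\<close> to be a
  small multiple of \<open>sqrt n\<close> gives a contradiction for large \<open>n\<close>; for small \<open>n\<close> the bound \<open>k \<ge> 2\<close>
  suffices, after decreasing \<open>c\<close>.
\<close>

section \<open>Averages over the discrete cube\<close>

text \<open>
  The extensional function space makes the cube a finite set; the coordinates from \<open>n\<close> on carry no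
  information.
\<close>
definition cube :: "nat \<Rightarrow> (nat \<Rightarrow> real) set" where
  "cube n = {..<n} \<rightarrow>\<^sub>E {-1, 1}"

definition cube_avg :: "nat \<Rightarrow> ((nat \<Rightarrow> real) \<Rightarrow> real) \<Rightarrow> real" where
  "cube_avg n f = (\<Sum>x\<in>cube n. f x) / 2 ^ n"

lemma finite_cube [simp]: "finite (cube n)"
  by (simp add: cube_def finite_PiE)

lemma card_cube: "card (cube n) = 2 ^ n"
  by (simp add: cube_def card_PiE numeral_2_eq_2)

lemma cube_nonempty [simp]: "cube n \<noteq> {}"
  by (simp add: cube_def PiE_eq_empty_iff)

lemma cube_square: "x \<in> cube n \<Longrightarrow> i < n \<Longrightarrow> x i * x i = 1"
  unfolding cube_def by (auto dest!: PiE_mem[where x = i])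

lemma cube_avg_cong: "(\<And>x. x \<in> cube n \<Longrightarrow> f x = g x) \<Longrightarrow> cube_avg n f = cube_avg n g"
  unfolding cube_avg_def by (simp cong: sum.cong)

lemma cube_avg_const: "cube_avg n (\<lambda>_. c) = c"
  by (simp add: cube_avg_def card_cube)

lemma cube_avg_add: "cube_avg n (\<lambda>x. f x + g x) = cube_avg n f + cube_avg n g"
  by (simp add: cube_avg_def sum.distrib add_divide_distrib)

lemma cube_avg_cmult: "cube_avg n (\<lambda>x. c * f x) = c * cube_avg n f"
  by (simp add: cube_avg_def sum_distrib_left)

lemma cube_avg_multc: "cube_avg n (\<lambda>x. f x * c) = cube_avg n f * c"
  by (simp add: cube_avg_def sum_distrib_right)

lemma cube_avg_divide: "cube_avg n (\<lambda>x. f x / c) = cube_avg n f / c"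
  by (simp add: divide_inverse cube_avg_multc)

lemma cube_avg_sum: "cube_avg n (\<lambda>x. \<Sum>i\<in>I. f i x) = (\<Sum>i\<in>I. cube_avg n (f i))"
  unfolding cube_avg_def by (subst sum.swap) (simp add: sum_divide_distrib)

lemma cube_avg_mono: "(\<And>x. x \<in> cube n \<Longrightarrow> f x \<le> g x) \<Longrightarrow> cube_avg n f \<le> cube_avg n g"
  unfolding cube_avg_def by (intro divide_right_mono sum_mono) auto

lemma cube_avg_nonneg: "(\<And>x. x \<in> cube n \<Longrightarrow> 0 \<le> f x) \<Longrightarrow> 0 \<le> cube_avg n f"
  unfolding cube_avg_def by (intro divide_nonneg_nonneg sum_nonneg) auto

lemma cube_avg_eq_0D:
  assumes "cube_avg n f = 0" "\<And>x. x \<in> cube n \<Longrightarrow> 0 \<le> f x" "x \<in> cube n"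
  shows "f x = 0"
  using assms by (simp add: cube_avg_def sum_nonneg_eq_0_iff)

text \<open>
  Splitting off the last sign is what the inductions on the dimension run on.
\<close>
lemma cube_avg_Suc:
  "cube_avg (Suc n) f = cube_avg n (\<lambda>x. (f (x(n := 1)) + f (x(n := -1))) / 2)"
proof -
  have "(\<Sum>x\<in>cube (Suc n). f x) = (\<Sum>(s, x)\<in>{-1, 1} \<times> cube n. f (x(n := s)))"
    unfolding cube_def lessThan_Suc PiE_insert_eq
    by (subst sum.reindex) (auto intro!: inj_combinator sum.cong)
  also have "\<dots> = (\<Sum>x\<in>cube n. f (x(n := 1)) + f (x(n := -1)))"
    by (subst sum.cartesian_product[symmetric]) (simp add: sum.distrib)
  finally show ?thesis
    by (simp add: cube_avg_def sum_divide_distrib)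
qed

lemma finite_attains_max:
  fixes f :: "'a \<Rightarrow> real"
  assumes "finite S" "S \<noteq> {}"
  obtains x where "x \<in> S" "\<And>z. z \<in> S \<Longrightarrow> f z \<le> f x"
proof -
  have "Max (f ` S) \<in> f ` S"
    using assms by (intro Max_in) auto
  then obtain x where x: "x \<in> S" "Max (f ` S) = f x"
    by blast
  have "f z \<le> f x" if "z \<in> S" for z
    using assms(1) that unfolding x(2)[symmetric] by (intro Max_ge) auto
  then show thesis
    using that x by blast
qed

text \<open>
  Flipping one coordinate permutes the cube. All orthogonality relations used below follow from this.
\<close>
lemma cube_avg_odd:
  assumes k: "k < n" and odd: "\<And>x. x \<in> cube n \<Longrightarrow> f (x(k := - x k)) = - f x"
  shows "cube_avg n f = 0"
proof -
  have "(\<Sum>x\<in>cube n. f x) = (\<Sum>x\<in>cube n. f (x(k := - x k)))"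
    by (rule sum.reindex_bij_witness[of _ "\<lambda>x. x(k := - x k)" "\<lambda>x. x(k := - x k)"])
       (use k in \<open>auto simp: cube_def PiE_iff extensional_def\<close>)
  also have "\<dots> = - (\<Sum>x\<in>cube n. f x)"
    by (simp add: odd sum_negf)
  finally show ?thesis
    by (simp add: cube_avg_def)
qed

lemma cube_avg_second_moment:
  assumes "i < n" "j < n"
  shows "cube_avg n (\<lambda>x. x i * x j) = (if i = j then 1 else 0)"
proof (cases "i = j")
  case True
  then show ?thesis
    using assms cube_avg_cong[of n "\<lambda>x. x i * x j" "\<lambda>_. 1"] by (simp add: cube_square cube_avg_const)
next
  case False
  then show ?thesis
    using assms by (simp add: cube_avg_odd[of i])
qed

lemma cube_avg_fourth_moment:
  assumes "i < n" "j < n" "p < n" "q < n" "p \<noteq> q"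
  shows "cube_avg n (\<lambda>x. x i * x j * (x p * x q)) = (if {i, j} = {p, q} then 1 else 0)"
proof (cases "{i, j} = {p, q}")
  case True
  then have "x i * x j * (x p * x q) = 1" if "x \<in> cube n" for x
  proof -
    have "(x i * x j) = (x p * x q)"
      using True by (auto simp: doubleton_eq_iff)
    then have "x i * x j * (x p * x q) = (x p * x p) * (x q * x q)"
      by (simp add: mult_ac)
    then show ?thesis
      using assms cube_square[OF that] by simp
  qed
  then have "cube_avg n (\<lambda>x. x i * x j * (x p * x q)) = cube_avg n (\<lambda>x. 1)"
    by (rule cube_avg_cong)
  then show ?thesis
    using True by (simp add: cube_avg_const)
next
  case False
  then consider "p \<notin> {i, j}" | "q \<notin> {i, j}"
    using assms by auto
  then have "cube_avg n (\<lambda>x. x i * x j * (x p * x q)) = 0"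
  proof cases
    case 1
    then show ?thesis using assms by (intro cube_avg_odd[of p]) auto
  next
    case 2
    then show ?thesis using assms by (intro cube_avg_odd[of q]) auto
  qed
  then show ?thesis
    using False by simp
qed

text \<open>
  Jensen's inequality for \<open>z \<mapsto> z\<^sup>2\<^sup>m\<close> and the probability density proportional to \<open>w\<close>, multiplied out
  so that it also covers \<open>w = 0\<close>.
\<close>
lemma cube_avg_power_mean:
  assumes w: "\<And>x. x \<in> cube n \<Longrightarrow> 0 \<le> w x"
  shows "(cube_avg n (\<lambda>x. w x * g x)) ^ (2 * m) * cube_avg n w
         \<le> cube_avg n w ^ (2 * m) * cube_avg n (\<lambda>x. w x * g x ^ (2 * m))"
proof (cases "cube_avg n w = 0")
  case True
  have "w x = 0" if "x \<in> cube n" for x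
    using cube_avg_eq_0D[OF True w that] by simp
  then have "cube_avg n (\<lambda>x. w x * h x) = 0" for h
    using cube_avg_cong[of n "\<lambda>x. w x * h x" "\<lambda>_. 0"] by (simp add: cube_avg_const)
  then show ?thesis
    using True by simp
next
  case False
  define c where "c = cube_avg n w"
  have c: "c > 0"
    using False cube_avg_nonneg[of n w] w by (simp add: c_def less_le)
  define u where "u x = w x / (2 ^ n * c)" for x
  have u: "sum u (cube n) = 1"
    using False by (simp add: u_def sum_divide_distrib[symmetric] c_def cube_avg_def)
  have E: "(\<Sum>x\<in>cube n. u x * h x) = cube_avg n (\<lambda>x. w x * h x) / c" for h
    by (simp add: u_def cube_avg_def sum_divide_distrib)
  have "(\<Sum>x\<in>cube n. u x *\<^sub>R g x) ^ (2 * m) \<le> (\<Sum>x\<in>cube n. u x * g x ^ (2 * m))"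
    using c w u
    by (intro convex_on_sum[where C = UNIV and f = "\<lambda>z. z ^ (2 * m)"] convex_power_even)
       (auto simp: u_def)
  then have "(cube_avg n (\<lambda>x. w x * g x) / c) ^ (2 * m) \<le> cube_avg n (\<lambda>x. w x * g x ^ (2 * m)) / c"
    by (simp add: E)
  then show ?thesis
    using c by (simp add: c_def[symmetric] power_divide field_simps)
qed

text \<open>
  The ratio of consecutive binomials is \<open>(2m - 2j - 1) / (2j + 1)\<close> times larger on the left than on
  the right; bounding it by \<open>2m\<close> gives the induction step.
\<close>
lemma binomial_double_le:
  "j \<le> m \<Longrightarrow> (2 * m) choose (2 * j) \<le> (m choose j) * (2 * m) ^ j"
proof (induction j)
  case 0
  then show ?case by simp
next
  case (Suc j)
  have ratio: "Suc k * (n choose Suc k) = (n - k) * (n choose k)" for n k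
    using binomial_absorption[of k n] binomial_absorb_comp[of n k] by simp
  have "(2 * j + 1) * (Suc j * 2 * ((2 * m) choose (2 * Suc j)))
        = (2 * j + 1) * ((2 * m - Suc (2 * j)) * ((2 * m) choose Suc (2 * j)))"
    using ratio[of "Suc (2 * j)" "2 * m"] by (simp add: mult_ac)
  also have "\<dots> = (2 * m - Suc (2 * j)) * ((2 * m - 2 * j) * ((2 * m) choose (2 * j)))"
    using ratio[of "2 * j" "2 * m"] by (metis Suc_eq_plus1 mult.left_commute)
  also have "\<dots> \<le> (2 * m) * ((2 * m - 2 * j) * ((m choose j) * (2 * m) ^ j))"
    using Suc by (intro mult_le_mono) auto
  also have "\<dots> = (2 * m) * (2 * ((m - j) * (m choose j)) * (2 * m) ^ j)"
    by (simp add: right_diff_distrib' mult_ac)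
  also have "\<dots> = (Suc j * 2) * ((m choose Suc j) * (2 * m) ^ Suc j)"
    unfolding ratio[of j m, symmetric] by (simp add: algebra_simps)
  finally have "(2 * j + 1) * ((2 * m) choose (2 * Suc j)) \<le> (m choose Suc j) * (2 * m) ^ Suc j"
    by (metis (no_types, lifting) mult.left_commute mult_le_cancel1 zero_less_Suc
        mult_pos_pos zero_less_numeral mult.assoc)
  then show ?case
    by (rule order_trans[rotated]) simp
qed

text \<open>
  The one-dimensional case of hypercontractivity. Only even powers of \<open>b\<close> survive the average over
  the sign, and the two binomial expansions can then be compared coefficient by coefficient.
\<close>
lemma two_point_inequality:
  fixes a b :: real
  shows "((a + b) ^ (2 * m) + (a - b) ^ (2 * m)) / 2 \<le> (a\<^sup>2 + 2 * real m * b\<^sup>2) ^ m"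
proof -
  have split: "(\<Sum>k\<le>2 * m. F k) = (\<Sum>j\<le>m. F (2 * j)) + (\<Sum>j<m. F (2 * j + 1))" for F :: "nat \<Rightarrow> real"
    by (induction m) (auto simp: algebra_simps)
  have "((a + b) ^ (2 * m) + (a - b) ^ (2 * m)) / 2
        = (\<Sum>k\<le>2 * m. real ((2 * m) choose k) * ((b ^ k + (- b) ^ k) / 2) * a ^ (2 * m - k))"
    using binomial_ring[of b a "2 * m"] binomial_ring[of "- b" a "2 * m"]
    by (simp add: sum.distrib[symmetric] sum_divide_distrib add.commute algebra_simps add_divide_distrib)
  also have "\<dots> = (\<Sum>j\<le>m. real ((2 * m) choose (2 * j)) * (b\<^sup>2) ^ j * (a\<^sup>2) ^ (m - j))"
    unfolding split by (simp add: power_mult[symmetric] right_diff_distrib')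
  also have "\<dots> \<le> (\<Sum>j\<le>m. real ((m choose j) * (2 * m) ^ j) * (b\<^sup>2) ^ j * (a\<^sup>2) ^ (m - j))"
    by (intro sum_mono mult_right_mono of_nat_mono binomial_double_le) auto
  also have "\<dots> = (2 * real m * b\<^sup>2 + a\<^sup>2) ^ m"
    unfolding binomial_ring by (simp add: power_mult_distrib mult_ac)
  finally show ?thesis by (simp add: add.commute)
qed

text \<open>
  The triangle inequality in \<open>L\<^sup>m\<close>, in the form of a bound on moments. It follows from convexity of
  \<open>z \<mapsto> z ^ m\<close> applied to \<open>(u + v) / (A + B)\<close>, a convex combination of \<open>u / A\<close> and \<open>v / B\<close> with
  weights \<open>A / (A + B)\<close> and \<open>B / (A + B)\<close>.
\<close>
lemma cube_avg_minkowski: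
  assumes u: "\<And>x. x \<in> cube n \<Longrightarrow> 0 \<le> u x" and v: "\<And>x. x \<in> cube n \<Longrightarrow> 0 \<le> v x"
    and A: "0 \<le> A" "cube_avg n (\<lambda>x. u x ^ m) \<le> A ^ m"
    and B: "0 \<le> B" "cube_avg n (\<lambda>x. v x ^ m) \<le> B ^ m"
    and m: "0 < m"
  shows "cube_avg n (\<lambda>x. (u x + v x) ^ m) \<le> (A + B) ^ m"
proof -
  have zero: "w x = 0"
    if "\<And>x. x \<in> cube n \<Longrightarrow> 0 \<le> w x" "cube_avg n (\<lambda>x. w x ^ m) \<le> 0 ^ m" "x \<in> cube n" for w x
    using cube_avg_eq_0D[of n "\<lambda>x. w x ^ m" x] cube_avg_nonneg[of n "\<lambda>x. w x ^ m"] that m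
    by (auto simp: zero_power)
  consider "A = 0" | "B = 0" | "A > 0" "B > 0"
    using A B by linarith
  then show ?thesis
  proof cases
    case 1
    then have "cube_avg n (\<lambda>x. (u x + v x) ^ m) = cube_avg n (\<lambda>x. v x ^ m)"
      using zero[of u] u A by (intro cube_avg_cong) simp
    then show ?thesis using 1 B by simp
  next
    case 2
    then have "cube_avg n (\<lambda>x. (u x + v x) ^ m) = cube_avg n (\<lambda>x. u x ^ m)"
      using zero[of v] v B by (intro cube_avg_cong) simp
    then show ?thesis using 2 A by simp
  next
    case 3
    define s where "s = A / (A + B)"
    have s: "0 \<le> s" "s \<le> 1" "1 - s = B / (A + B)"
      using 3 by (auto simp: s_def field_simps)
    have cvx: "convex_on {0..} (\<lambda>z::real. z ^ m)"
      by (rule convex_on_realI[where f' = "\<lambda>z. real m * z ^ (m - 1)"])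
         (auto intro!: derivative_eq_intros mult_left_mono power_mono)
    have "((u x + v x) / (A + B)) ^ m \<le> s * (u x / A) ^ m + (1 - s) * (v x / B) ^ m"
      if x: "x \<in> cube n" for x
    proof -
      have "(u x + v x) / (A + B) = (1 - s) *\<^sub>R (v x / B) + s *\<^sub>R (u x / A)"
      proof -
        have "(1 - s) * (v x / B) = v x / (A + B)"
          unfolding s(3) using 3 by simp
        moreover have "s * (u x / A) = u x / (A + B)"
          unfolding s_def using 3 by simp
        ultimately show ?thesis
          by (simp add: add_divide_distrib)
      qed
      also have "\<dots> ^ m \<le> (1 - s) * (v x / B) ^ m + s * (u x / A) ^ m"
        using u[OF x] v[OF x] 3 s by (intro convex_onD[OF cvx]) auto
      finally show ?thesis by simp
    qed
    then have "cube_avg n (\<lambda>x. ((u x + v x) / (A + B)) ^ m)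
        \<le> cube_avg n (\<lambda>x. s * (u x / A) ^ m + (1 - s) * (v x / B) ^ m)"
      by (rule cube_avg_mono)
    also have "\<dots> = s * (cube_avg n (\<lambda>x. u x ^ m) / A ^ m) + (1 - s) * (cube_avg n (\<lambda>x. v x ^ m) / B ^ m)"
      by (simp only: cube_avg_add cube_avg_cmult power_divide cube_avg_divide)
    also have "\<dots> \<le> s * 1 + (1 - s) * 1"
      using A B 3 s by (intro add_mono mult_left_mono) auto
    finally have "cube_avg n (\<lambda>x. (u x + v x) ^ m) / (A + B) ^ m \<le> 1"
      by (simp only: power_divide cube_avg_divide) simp
    then show ?thesis
      using 3 by simp
  qed
qed

text \<open>
  The induction step for moments of polynomials in the signs: \<open>a\<close> and \<open>b\<close> are the two parts of a
  multilinear polynomial with respect to its last variable. Averaging over that variable uses the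
  two-point inequality, and averaging over the others uses the triangle inequality.
\<close>
lemma cube_avg_hypercontractive_step:
  assumes indep: "\<And>x s. a (x(n := s)) = a x" "\<And>x s. b (x(n := s)) = b x"
    and A: "0 \<le> A" "cube_avg n (\<lambda>x. a x ^ (2 * m)) \<le> A ^ m"
    and B: "0 \<le> B" "cube_avg n (\<lambda>x. b x ^ (2 * m)) \<le> B ^ m"
    and m: "0 < m"
  shows "cube_avg (Suc n) (\<lambda>x. (a x + x n * b x) ^ (2 * m)) \<le> (A + 2 * real m * B) ^ m"
proof -
  have "cube_avg (Suc n) (\<lambda>x. (a x + x n * b x) ^ (2 * m))
        \<le> cube_avg n (\<lambda>x. ((a x)\<^sup>2 + 2 * real m * (b x)\<^sup>2) ^ m)"
    unfolding cube_avg_Suc using two_point_inequality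
    by (intro cube_avg_mono) (simp add: indep)
  also have "\<dots> \<le> (A + 2 * real m * B) ^ m"
  proof (rule cube_avg_minkowski)
    have "cube_avg n (\<lambda>x. (2 * real m * (b x)\<^sup>2) ^ m) = (2 * real m) ^ m * cube_avg n (\<lambda>x. b x ^ (2 * m))"
      by (simp only: power_mult_distrib cube_avg_cmult power_mult)
    also have "\<dots> \<le> (2 * real m) ^ m * B ^ m"
      using B by (intro mult_left_mono) auto
    finally show "cube_avg n (\<lambda>x. (2 * real m * (b x)\<^sup>2) ^ m) \<le> (2 * real m * B) ^ m"
      by (simp only: power_mult_distrib)
  qed (use A B m in \<open>auto simp: power_mult\<close>)
  finally show ?thesis .
qed

text \<open>
  Khintchine's inequality for even moments. The split-off part is the constant \<open>l n\<close>.
\<close>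
lemma linear_form_moment:
  assumes m: "0 < m"
  shows "cube_avg n (\<lambda>x. (\<Sum>p<n. l p * x p) ^ (2 * m)) \<le> (2 * real m * (\<Sum>p<n. (l p)\<^sup>2)) ^ m"
proof (induction n)
  case 0
  then show ?case using m by (simp add: cube_avg_const zero_power)
next
  case (Suc n)
  have "cube_avg (Suc n) (\<lambda>x. ((\<Sum>p<n. l p * x p) + x n * l n) ^ (2 * m))
        \<le> (2 * real m * (\<Sum>p<n. (l p)\<^sup>2) + 2 * real m * (l n)\<^sup>2) ^ m"
    using Suc m
    by (intro cube_avg_hypercontractive_step)
       (auto simp: cube_avg_const power_mult sum_nonneg zero_power)
  then show ?case by (simp add: algebra_simps)
qed

text \<open>
  Bonami's lemma in degree two. The split-off part is a linear form, so that \<open>linear_form_moment\<close>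
  supplies the second factor \<open>2m\<close>.
\<close>
lemma quadratic_form_moment:
  assumes m: "0 < m"
  shows "cube_avg n (\<lambda>x. (\<Sum>q<n. \<Sum>p<q. c p q * (x p * x q)) ^ (2 * m))
         \<le> ((2 * real m)\<^sup>2 * (\<Sum>q<n. \<Sum>p<q. (c p q)\<^sup>2)) ^ m"
proof (induction n)
  case 0
  then show ?case using m by (simp add: cube_avg_const zero_power)
next
  case (Suc n)
  have "cube_avg (Suc n)
          (\<lambda>x. ((\<Sum>q<n. \<Sum>p<q. c p q * (x p * x q)) + x n * (\<Sum>p<n. c p n * x p)) ^ (2 * m))
        \<le> ((2 * real m)\<^sup>2 * (\<Sum>q<n. \<Sum>p<q. (c p q)\<^sup>2)
            + 2 * real m * (2 * real m * (\<Sum>p<n. (c p n)\<^sup>2))) ^ m"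
    using Suc m linear_form_moment[OF m]
    by (intro cube_avg_hypercontractive_step) (auto simp: sum_nonneg)
  then show ?case
    by (simp add: algebra_simps sum_distrib_left power2_eq_square)
qed

section \<open>Nonnegative factorizations of the slack matrix\<close>

definition fourier2 :: "nat \<Rightarrow> ((nat \<Rightarrow> real) \<Rightarrow> real) \<Rightarrow> nat \<Rightarrow> nat \<Rightarrow> real" where
  "fourier2 n f p q = cube_avg n (\<lambda>x. f x * (x p * x q))"

definition weight2 :: "nat \<Rightarrow> ((nat \<Rightarrow> real) \<Rightarrow> real) \<Rightarrow> real" where
  "weight2 n f = (\<Sum>q<n. \<Sum>p<q. (fourier2 n f p q)\<^sup>2)"

lemma weight2_nonneg: "0 \<le> weight2 n f"
  by (simp add: weight2_def sum_nonneg)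

text \<open>
  Let \<open>G\<close> be the degree-two part of \<open>f\<close>. The weight \<open>W\<close> of \<open>G\<close> equals the average of \<open>f * G\<close>. Raising this
  to the power \<open>2m\<close>, Jensen's inequality moves the power onto \<open>G\<close>, at the cost of a factor \<open>M\<close> the
  density \<open>f\<close> disappears, and the moment bound for quadratic forms leaves a multiple of \<open>W ^ m\<close>. One
  factor \<open>W ^ m\<close> cancels. With \<open>M = e\<^sup>2\<^sup>m\<close> times the average of \<open>f\<close> this says \<open>W = O(m\<^sup>2)\<close> times the
  square of that average.
\<close>
lemma level_two_inequality:
  assumes m: "0 < m" and f: "\<And>x. x \<in> cube n \<Longrightarrow> 0 \<le> f x" "\<And>x. x \<in> cube n \<Longrightarrow> f x \<le> M"
  shows "weight2 n f ^ m \<le> cube_avg n f ^ (2 * m - 1) * M * (2 * real m) ^ (2 * m)"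
proof -
  define W where "W = weight2 n f"
  define \<alpha> where "\<alpha> = cube_avg n f"
  define G where "G x = (\<Sum>q<n. \<Sum>p<q. fourier2 n f p q * (x p * x q))" for x
  have W: "cube_avg n (\<lambda>x. f x * G x) = W"
  proof -
    have "cube_avg n (\<lambda>x. f x * G x)
        = cube_avg n (\<lambda>x. \<Sum>q<n. \<Sum>p<q. fourier2 n f p q * (f x * (x p * x q)))"
      by (simp add: G_def sum_distrib_left mult_ac)
    also have "\<dots> = W"
      by (simp add: cube_avg_sum cube_avg_cmult W_def weight2_def fourier2_def power2_eq_square)
    finally show ?thesis .
  qed
  have W0: "0 \<le> W" and \<alpha>0: "0 \<le> \<alpha>"
    using f by (auto simp: W_def \<alpha>_def weight2_nonneg cube_avg_nonneg)
  have M0: "0 \<le> M"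
    using f cube_nonempty by (meson all_not_in_conv order_trans)
  show ?thesis
  proof (cases "W = 0 \<or> \<alpha> = 0")
    case True
    have "W = 0" if "\<alpha> = 0"
    proof -
      have "f x = 0" if "x \<in> cube n" for x
        using cube_avg_eq_0D[of n f x] f that \<open>\<alpha> = 0\<close> by (simp add: \<alpha>_def)
      then have "cube_avg n (\<lambda>x. f x * G x) = cube_avg n (\<lambda>_. 0)"
        by (intro cube_avg_cong) simp
      then show ?thesis using W by (simp add: cube_avg_const)
    qed
    then show ?thesis
      using True m M0 \<alpha>0 by (auto simp: zero_power simp flip: W_def \<alpha>_def)
  next
    case False
    have "W ^ (2 * m) * \<alpha> \<le> \<alpha> ^ (2 * m) * cube_avg n (\<lambda>x. f x * G x ^ (2 * m))"
      using cube_avg_power_mean[of n f G m] f by (simp add: W \<alpha>_def)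
    also have "cube_avg n (\<lambda>x. f x * G x ^ (2 * m)) \<le> cube_avg n (\<lambda>x. M * G x ^ (2 * m))"
      using f by (intro cube_avg_mono mult_right_mono) (auto simp: power_mult)
    also have "\<dots> \<le> M * ((2 * real m)\<^sup>2 * W) ^ m"
      unfolding cube_avg_cmult G_def W_def weight2_def
      using M0 quadratic_form_moment[OF m] by (intro mult_left_mono) auto
    also have "((2 * real m)\<^sup>2 * W) ^ m = (2 * real m) ^ (2 * m) * W ^ m"
      by (simp only: power_mult_distrib power_mult)
    finally have "W ^ (2 * m) * \<alpha> \<le> \<alpha> ^ (2 * m) * (M * ((2 * real m) ^ (2 * m) * W ^ m))"
      using \<alpha>0 by (simp add: mult_left_mono)
    moreover have "\<alpha> ^ (2 * m) = \<alpha> ^ (2 * m - 1) * \<alpha>"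
      using m by (metis mult.commute power_eq_if zero_neq_numeral mult_eq_0_iff less_irrefl)
    moreover have "W ^ (2 * m) = W ^ m * W ^ m"
      by (simp add: mult_2 power_add)
    ultimately have "(W ^ m) * (W ^ m * \<alpha>)
        \<le> (\<alpha> ^ (2 * m - 1) * M * (2 * real m) ^ (2 * m)) * (W ^ m * \<alpha>)"
      by (simp only: mult_ac)
    then show ?thesis
      using False W0 \<alpha>0 by (auto simp flip: W_def \<alpha>_def simp: mult_le_cancel_right)
  qed
qed

lemma fourier2_mult:
  "fourier2 n f p q * fourier2 n g p q
   = cube_avg n (\<lambda>x. cube_avg n (\<lambda>y. f x * g y * ((x p * x q) * (y p * y q))))"
proof -
  have "cube_avg n (\<lambda>y. f x * g y * ((x p * x q) * (y p * y q)))
        = (f x * (x p * x q)) * fourier2 n g p q" for x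
    unfolding fourier2_def by (simp flip: cube_avg_cmult add: mult_ac)
  then show ?thesis
    by (simp add: cube_avg_multc fourier2_def)
qed

lemma sum_pairs_indicator:
  fixes p q n :: nat
  assumes "p < n" "q < n" "p \<noteq> q"
  shows "(\<Sum>i<n. \<Sum>j<n. if {i, j} = {p, q} then 1 else 0 :: real) = 2"
proof -
  have "(\<Sum>i<n. \<Sum>j<n. if {i, j} = {p, q} then 1 else 0 :: real)
        = (\<Sum>z\<in>{..<n} \<times> {..<n}. if {fst z, snd z} = {p, q} then 1 else 0)"
    by (simp add: sum.cartesian_product case_prod_unfold)
  also have "\<dots> = (\<Sum>z\<in>{(p, q), (q, p)}. 1)"
    using assms by (intro sum.mono_neutral_cong_right) (auto simp: doubleton_eq_iff)
  finally show ?thesis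
    using assms by simp
qed

text \<open>
  A nonnegative factorization of the matrix with entries \<open>\<sigma> \<langle>x, y\<rangle>\<^sup>2 + \<tau> y\<^sup>T A y\<close>. The condition
  \<open>\<sigma> * n + \<tau> = 1\<close> normalizes its mean to \<open>1\<close>; it holds for \<open>\<sigma> = (1 - \<epsilon>) / n\<close> and \<open>\<tau> = \<epsilon>\<close>.
\<close>
locale cube_slack_factorization =
  fixes n :: nat and \<sigma> \<tau> :: real and A :: "nat \<Rightarrow> nat \<Rightarrow> real"
    and I :: "'i set" and a b :: "'i \<Rightarrow> (nat \<Rightarrow> real) \<Rightarrow> real"
  assumes total: "\<sigma> * n + \<tau> = 1" and trace: "(\<Sum>p<n. A p p) = 1"
    and fin: "finite I"
    and nonneg: "\<And>i x. i \<in> I \<Longrightarrow> x \<in> cube n \<Longrightarrow> 0 \<le> a i x" "\<And>i x. i \<in> I \<Longrightarrow> x \<in> cube n \<Longrightarrow> 0 \<le> b i x"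
    and slack: "\<And>x y. x \<in> cube n \<Longrightarrow> y \<in> cube n \<Longrightarrow>
      (\<Sum>i\<in>I. a i x * b i y)
      = \<sigma> * (\<Sum>p<n. x p * y p)\<^sup>2 + \<tau> * (\<Sum>p<n. \<Sum>q<n. y p * A p q * y q)"
    and bounded: "\<And>x y. x \<in> cube n \<Longrightarrow> y \<in> cube n \<Longrightarrow> (\<Sum>i\<in>I. a i x * b i y) \<le> n"
begin

lemma slack_expand:
  assumes "x \<in> cube n" "y \<in> cube n"
  shows "(\<Sum>i\<in>I. a i x * b i y)
    = (\<Sum>k<n. \<Sum>l<n. \<sigma> * ((x k * x l) * (y k * y l)) + \<tau> * A k l * (y k * y l))"
proof -
  have "(\<Sum>p<n. x p * y p)\<^sup>2 = (\<Sum>k<n. \<Sum>l<n. (x k * x l) * (y k * y l))"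
    by (simp add: power2_eq_square sum_product mult_ac)
  then show ?thesis
    unfolding slack[OF assms] by (simp add: sum.distrib sum_distrib_left mult_ac)
qed

definition mass :: "'i \<Rightarrow> real" where
  "mass i = cube_avg n (a i) * cube_avg n (b i)"

lemma mass_nonneg: "i \<in> I \<Longrightarrow> 0 \<le> mass i"
  by (simp add: mass_def nonneg cube_avg_nonneg)

lemma sum_mass: "(\<Sum>i\<in>I. mass i) = 1"
proof -
  have "(\<Sum>i\<in>I. mass i) = cube_avg n (\<lambda>x. cube_avg n (\<lambda>y. \<Sum>i\<in>I. a i x * b i y))"
    by (simp add: mass_def cube_avg_sum cube_avg_cmult cube_avg_multc)
  also have "\<dots> = cube_avg n (\<lambda>x. cube_avg n (\<lambda>y.
      \<Sum>k<n. \<Sum>l<n. \<sigma> * ((x k * x l) * (y k * y l)) + \<tau> * A k l * (y k * y l)))"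
    by (intro cube_avg_cong slack_expand)
  also have "\<dots> = (\<Sum>k<n. \<Sum>l<n. \<sigma> * (if k = l then 1 else 0)
                                 + \<tau> * A k l * (if k = l then 1 else 0))"
    by (simp add: cube_avg_sum cube_avg_add cube_avg_cmult cube_avg_multc cube_avg_const
        cube_avg_second_moment) (auto intro!: sum.cong)
  also have "\<dots> = 1"
    using trace total
    by (simp add: sum.distrib if_distrib mult.commute flip: sum_distrib_left cong: if_cong)
  finally show ?thesis .
qed

text \<open>
  Orthogonality leaves exactly the two ordered index pairs \<open>(p, q)\<close> and \<open>(q, p)\<close> of the first
  summand. The matrix \<open>A\<close> disappears because its summand does not depend on \<open>x\<close>, and \<open>x p * x q\<close>
  has mean \<open>0\<close>.
\<close>
lemma sum_fourier2:
  assumes "p < n" "q < n" "p \<noteq> q"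
  shows "(\<Sum>i\<in>I. fourier2 n (a i) p q * fourier2 n (b i) p q) = 2 * \<sigma>"
proof -
  have "(\<Sum>i\<in>I. fourier2 n (a i) p q * fourier2 n (b i) p q)
      = cube_avg n (\<lambda>x. cube_avg n (\<lambda>y. (\<Sum>i\<in>I. a i x * b i y) * ((x p * x q) * (y p * y q))))"
    by (simp add: fourier2_mult cube_avg_sum sum_distrib_right)
  also have "\<dots> = cube_avg n (\<lambda>x. cube_avg n (\<lambda>y. \<Sum>k<n. \<Sum>l<n.
      \<sigma> * ((x k * x l * (x p * x q)) * (y k * y l * (y p * y q)))
        + \<tau> * A k l * ((x p * x q) * (y k * y l * (y p * y q)))))"
    by (intro cube_avg_cong) (simp add: slack_expand sum_distrib_right sum_distrib_left algebra_simps)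
  also have "\<dots> = (\<Sum>k<n. \<Sum>l<n. \<sigma> * (if {k, l} = {p, q} then 1 else 0))"
    using assms
    by (simp add: cube_avg_sum cube_avg_add cube_avg_cmult cube_avg_multc
        cube_avg_second_moment cube_avg_fourth_moment) (intro sum.cong refl; simp)
  also have "\<dots> = \<sigma> * 2"
    unfolding sum_pairs_indicator[OF assms, symmetric] by (simp only: sum_distrib_left)
  finally show ?thesis by simp
qed

definition correlation :: "'i \<Rightarrow> real" where
  "correlation i = (\<Sum>q<n. \<Sum>p<q. fourier2 n (a i) p q * fourier2 n (b i) p q)"

lemma sum_correlation: "(\<Sum>i\<in>I. correlation i) = \<sigma> * (real n * (real n - 1))"
proof -
  have "(\<Sum>i\<in>I. correlation i)
      = (\<Sum>q<n. \<Sum>p<q. \<Sum>i\<in>I. fourier2 n (a i) p q * fourier2 n (b i) p q)"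
    unfolding correlation_def by (subst sum.swap, rule sum.cong[OF refl], rule sum.swap)
  also have "\<dots> = (\<Sum>q<n. real q * (2 * \<sigma>))"
    by (simp add: sum_fourier2)
  also have "\<dots> = (\<Sum>q<n. real q) * (2 * \<sigma>)"
    by (simp only: sum_distrib_right)
  also have "(\<Sum>q<n. real q) = n * (real n - 1) / 2"
    by (induction n) (auto simp: field_simps)
  finally show ?thesis
    by simp
qed

text \<open>
  By Cauchy--Schwarz the correlation of a term is at most the product of the degree-two norms of
  \<open>a i\<close> and \<open>b i\<close>. The level-two inequality is applied with the maxima of the two functions, whose product
  is at most \<open>n\<close> because a single term is dominated by the whole matrix.
\<close>
lemma correlation_power_le:
  assumes i: "i \<in> I" and m: "0 < m"
  shows "\<bar>correlation i\<bar> ^ (2 * m) \<le> mass i ^ (2 * m - 1) * n * (4 * (real m)\<^sup>2) ^ (2 * m)"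
proof -
  let ?J = "SIGMA q:{..<n}. {..<q}"
  have "(correlation i)\<^sup>2 = (\<Sum>(q, p)\<in>?J. fourier2 n (a i) p q * fourier2 n (b i) p q)\<^sup>2"
    by (simp add: correlation_def sum.Sigma)
  also have "\<dots> \<le> (\<Sum>(q, p)\<in>?J. (fourier2 n (a i) p q)\<^sup>2) * (\<Sum>(q, p)\<in>?J. (fourier2 n (b i) p q)\<^sup>2)"
    unfolding case_prod_unfold by (rule Cauchy_Schwarz_ineq_sum)
  also have "\<dots> = weight2 n (a i) * weight2 n (b i)"
    by (simp add: weight2_def sum.Sigma)
  finally have "((correlation i)\<^sup>2) ^ m \<le> (weight2 n (a i) * weight2 n (b i)) ^ m"
    by (rule power_mono) simp
  also have "\<dots> = weight2 n (a i) ^ m * weight2 n (b i) ^ m"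
    by (rule power_mult_distrib)
  also have "\<dots> \<le> mass i ^ (2 * m - 1) * n * (4 * (real m)\<^sup>2) ^ (2 * m)"
  proof -
    obtain x where x: "x \<in> cube n" "\<And>z. z \<in> cube n \<Longrightarrow> a i z \<le> a i x"
      using finite_attains_max[of "cube n" "a i"] by auto
    obtain y where y: "y \<in> cube n" "\<And>z. z \<in> cube n \<Longrightarrow> b i z \<le> b i y"
      using finite_attains_max[of "cube n" "b i"] by auto
    have "a i x * b i y \<le> (\<Sum>i\<in>I. a i x * b i y)"
      using i fin x y nonneg by (intro member_le_sum) auto
    then have ab: "a i x * b i y \<le> n"
      using bounded[OF x(1) y(1)] by linarith
    have "weight2 n (a i) ^ m * weight2 n (b i) ^ m
        \<le> (cube_avg n (a i) ^ (2 * m - 1) * a i x * (2 * real m) ^ (2 * m))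
          * (cube_avg n (b i) ^ (2 * m - 1) * b i y * (2 * real m) ^ (2 * m))"
      using i x y nonneg
      by (intro mult_mono level_two_inequality m) (auto simp: weight2_nonneg cube_avg_nonneg)
    also have "\<dots> = mass i ^ (2 * m - 1) * (a i x * b i y) * ((2 * real m) * (2 * real m)) ^ (2 * m)"
      by (simp only: mass_def power_mult_distrib mult_ac)
    also have "\<dots> \<le> mass i ^ (2 * m - 1) * n * ((2 * real m) * (2 * real m)) ^ (2 * m)"
      using ab mass_nonneg[OF i] by (intro mult_right_mono mult_left_mono) auto
    finally show ?thesis
      by (simp add: power2_eq_square)
  qed
  finally show ?thesis
    by (simp add: power_mult)
qed

text \<open>
  A term of mass at least \<open>1 / r\<close>, with \<open>r\<close> the number of terms, has
  \<open>n \<le> r * n * mass i \<le> e\<^sup>2\<^sup>m * mass i\<close>, so that its correlation is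
  at most \<open>4 e m\<^sup>2\<close> times its mass. Replacing the mass by \<open>mass i + 1 / r\<close> treats light terms in the
  same way and only doubles the total mass.
\<close>
lemma few_terms_imp_small_dimension:
  assumes m: "0 < m" and few: "card I * n \<le> exp (2 * real m)"
  shows "\<sigma> * (real n * (real n - 1)) \<le> 8 * exp 1 * (real m)\<^sup>2"
proof -
  define r where "r = real (card I)"
  have "I \<noteq> {}"
    using sum_mass by auto
  then have r: "r > 0"
    using fin by (simp add: r_def card_gt_0_iff)
  have le: "correlation i \<le> (mass i + 1 / r) * (exp 1 * (4 * (real m)\<^sup>2))" if i: "i \<in> I" for i
  proof -
    have pos: "0 \<le> mass i" "0 < mass i + 1 / r"
      using mass_nonneg[OF i] r by (auto simp: add_nonneg_pos)
    have e: "exp 1 ^ (2 * m) = exp (2 * real m)"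
      by (simp flip: exp_of_nat_mult)
    have "real n \<le> 1 / r * exp (2 * real m)"
      using few r by (simp add: r_def field_simps)
    also have "\<dots> \<le> (mass i + 1 / r) * exp 1 ^ (2 * m)"
      unfolding e using pos by (intro mult_right_mono) auto
    finally have n_le: "real n \<le> (mass i + 1 / r) * exp 1 ^ (2 * m)" .
    have "\<bar>correlation i\<bar> ^ (2 * m) \<le> mass i ^ (2 * m - 1) * n * (4 * (real m)\<^sup>2) ^ (2 * m)"
      by (rule correlation_power_le[OF i m])
    also have "\<dots> \<le> (mass i + 1 / r) ^ (2 * m - 1) * ((mass i + 1 / r) * exp 1 ^ (2 * m))
                     * (4 * (real m)\<^sup>2) ^ (2 * m)"
      using pos r n_le by (intro mult_right_mono mult_mono power_mono) auto
    also have "\<dots> = ((mass i + 1 / r) * (exp 1 * (4 * (real m)\<^sup>2))) ^ (2 * m)"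
      using m power_minus_mult[of "2 * m" "mass i + 1 / r"]
      by (simp only: power_mult_distrib mult_ac)
    finally have "\<bar>correlation i\<bar> \<le> (mass i + 1 / r) * (exp 1 * (4 * (real m)\<^sup>2))"
      using m pos by (subst (asm) power_mono_iff) auto
    then show ?thesis by simp
  qed
  have "\<sigma> * (real n * (real n - 1)) \<le> (\<Sum>i\<in>I. (mass i + 1 / r) * (exp 1 * (4 * (real m)\<^sup>2)))"
    unfolding sum_correlation[symmetric] by (intro sum_mono le)
  also have "\<dots> = (\<Sum>i\<in>I. mass i + 1 / r) * (exp 1 * (4 * (real m)\<^sup>2))"
    by (simp only: sum_distrib_right)
  also have "(\<Sum>i\<in>I. mass i + 1 / r) = 2"
    using r by (simp add: sum.distrib sum_mass r_def)
  finally show ?thesis by simp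
qed

end

section \<open>Affine functionals and the facets of a polytope\<close>

definition affine_functional :: "('a::real_vector \<Rightarrow> real) \<Rightarrow> bool" where
  "affine_functional g \<longleftrightarrow> (\<exists>\<phi> c. linear \<phi> \<and> g = (\<lambda>x. \<phi> x + c))"

lemma affine_functional_linear_add: "linear \<phi> \<Longrightarrow> affine_functional (\<lambda>x. \<phi> x + c)"
  by (auto simp: affine_functional_def)

lemma affine_functional_add:
  assumes "affine_functional g" "affine_functional h"
  shows "affine_functional (\<lambda>x. g x + t * h x)"
proof -
  obtain \<phi> c \<psi> d where *: "linear \<phi>" "g = (\<lambda>x. \<phi> x + c)" "linear \<psi>" "h = (\<lambda>x. \<psi> x + d)"
    using assms by (auto simp: affine_functional_def)
  have "linear (\<lambda>x. \<phi> x + t * \<psi> x)"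
    using linear_compose_add[OF *(1) linear_compose_scale_right[OF *(3), of t]] by simp
  moreover have "(\<lambda>x. g x + t * h x) = (\<lambda>x. (\<phi> x + t * \<psi> x) + (c + t * d))"
    by (simp add: * algebra_simps)
  ultimately show ?thesis
    unfolding affine_functional_def by blast
qed

lemma affine_functional_combine:
  assumes "affine_functional g"
  shows "g ((1 - u) *\<^sub>R x + u *\<^sub>R y) = (1 - u) * g x + u * g y"
proof -
  obtain \<phi> c where *: "linear \<phi>" "g = (\<lambda>x. \<phi> x + c)"
    using assms by (auto simp: affine_functional_def)
  show ?thesis
    by (simp add: * linear_add[OF *(1)] linear_scale[OF *(1)]) (simp add: algebra_simps)
qed

lemma affine_functional_nonneg_hull:
  assumes g: "affine_functional g" and nn: "\<And>v. v \<in> V \<Longrightarrow> 0 \<le> g v" and x: "x \<in> convex hull V"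
  shows "0 \<le> g x"
proof -
  have "convex {x. 0 \<le> g x}"
    unfolding convex_alt by (auto simp: affine_functional_combine[OF g] add_nonneg_nonneg)
  then have "convex hull V \<subseteq> {x. 0 \<le> g x}"
    using nn by (intro hull_minimal) auto
  then show ?thesis using x by auto
qed

lemma affine_functional_zero_hull:
  assumes g: "affine_functional g" and nn: "\<And>v. v \<in> V \<Longrightarrow> g v = 0" and x: "x \<in> affine hull V"
  shows "g x = 0"
proof -
  have "affine {x. g x = 0}"
    unfolding affine_alt by (auto simp: affine_functional_combine[OF g])
  then have "affine hull V \<subseteq> {x. g x = 0}"
    using nn by (intro hull_minimal) auto
  then show ?thesis using x by auto
qed

text \<open>
  After moving a point of \<open>S\<close> to the origin, extend the functional that vanishes on a basis of the span
  of \<open>S\<close> and is \<open>1\<close> at \<open>w\<close>. Separation from an affine hull is purely algebraic and holds in every real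
  vector space.
\<close>
lemma affine_functional_separates:
  assumes S: "S \<noteq> {}" and w: "w \<notin> affine hull S"
  obtains l where "affine_functional l" "\<And>x. x \<in> S \<Longrightarrow> l x = 0" "l w = 1"
proof -
  obtain a where a: "a \<in> S" using S by auto
  let ?T = "(\<lambda>x. - a + x) ` S"
  obtain B where B: "B \<subseteq> ?T" "independent B" "?T \<subseteq> span B"
    using maximal_independent_subset[of ?T] by blast
  have "B \<subseteq> span ?T"
    using B(1) span_superset by (rule order_trans)
  then have spanB: "span B = span ?T"
    using B(3) by (simp add: span_eq)
  have hull: "affine hull S = (\<lambda>x. a + x) ` span ?T"
    using affine_hull_insert_span_gen[of a "S"] a by (simp add: insert_absorb)
  have nw: "w - a \<notin> span B"
  proof
    assume "w - a \<in> span B"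
    then have "a + (w - a) \<in> affine hull S"
      unfolding hull spanB by (rule imageI)
    then show False
      using w by simp
  qed
  then have "independent (insert (w - a) B)"
    using B(2) by (simp add: independent_insert)
  then obtain \<phi> :: "'a \<Rightarrow> real" where
    \<phi>: "linear \<phi>" "\<And>x. x \<in> insert (w - a) B \<Longrightarrow> \<phi> x = (if x = w - a then 1 else 0)"
    using linear_independent_extend[of "insert (w - a) B" "\<lambda>x. if x = w - a then 1 else 0 :: real"]
    by blast
  have "\<phi> x = 0" if "x \<in> B" for x
    using \<phi>(2)[of x] that nw span_base by auto
  then have z: "\<phi> x = 0" if "x \<in> span B" for x
    using linear_eq_0_on_span[OF \<phi>(1)] that by blast
  show thesis
  proof
    show "affine_functional (\<lambda>x. \<phi> x + - \<phi> a)"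
      by (rule affine_functional_linear_add[OF \<phi>(1)])
    show "\<phi> x + - \<phi> a = 0" if "x \<in> S" for x
    proof -
      have "x - a \<in> span B"
        unfolding spanB using that by (intro span_base) auto
      then show ?thesis
        using z[of "x - a"] linear_diff[OF \<phi>(1)] by simp
    qed
    show "\<phi> w + - \<phi> a = 1"
      using \<phi>(2)[of "w - a"] linear_diff[OF \<phi>(1), of w a] by simp
  qed
qed

text \<open>
  The dimension of a set is defined by choosing an affine basis of its hull. Translating a base point
  of each basis to the origin reduces uniqueness of its size to that for linear bases, which makes
  sense in any real vector space.
\<close>
lemma card_affine_basis_unique:
  assumes B: "\<not> affine_dependent B" "finite B" and C: "\<not> affine_dependent C"
    and eq: "affine hull B = affine hull C"
  shows "finite C \<and> card C = card B"
proof (cases "B = {}")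
  case True
  then show ?thesis using eq by auto
next
  case False
  then have "C \<noteq> {}" using eq by auto
  obtain b c where b: "b \<in> B" and c: "c \<in> C" using False \<open>C \<noteq> {}\<close> by auto
  let ?B = "(\<lambda>x. - b + x) ` (B - {b})" and ?C = "(\<lambda>x. - c + x) ` (C - {c})"
  have ind: "independent ?B" "independent ?C"
    using B C b c affine_dependent_iff_dependent2 by blast+
  have hB: "affine hull B = (\<lambda>x. b + x) ` span ?B"
    using affine_hull_insert_span_gen[of b "B - {b}"] b by (simp add: insert_absorb)
  have hC: "affine hull C = (\<lambda>x. c + x) ` span ?C"
    using affine_hull_insert_span_gen[of c "C - {c}"] c by (simp add: insert_absorb)
  have "c \<in> affine hull B"
    unfolding eq using c by (simp add: hull_inc)
  then have cb: "c - b \<in> span ?B"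
    unfolding hB by auto
  have "span ?C = (\<lambda>x. (b - c) + x) ` span ?B"
  proof -
    have "span ?C = (\<lambda>x. - c + x) ` (affine hull C)"
      unfolding hC by (auto simp: image_image)
    also have "\<dots> = (\<lambda>x. (b - c) + x) ` span ?B"
      unfolding eq[symmetric] hB by (simp add: image_image algebra_simps)
    finally show ?thesis .
  qed
  also have "\<dots> = span ?B"
  proof -
    have "b - c \<in> span ?B" using cb span_neg[OF cb] by simp
    then show ?thesis
      by (auto simp: span_add image_iff intro!: bexI[of _ "_ - (b - c)"] span_diff)
  qed
  finally have "span ?C = span ?B" .
  then obtain f where f: "bij_betw f ?B ?C"
    using real_vector.bij_if_span_eq_span_bases[OF ind] by metis
  have inj: "inj_on (\<lambda>x. - d + x) X" for d :: 'a and X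
    by (auto simp: inj_on_def)
  have "finite ?C" using f B(2) bij_betw_finite by blast
  then have "finite (C - {c})"
    using finite_image_iff[OF inj] by blast
  moreover have "card (C - {c}) = card (B - {b})"
    using bij_betw_same_card[OF f] card_image[OF inj] by metis
  ultimately show ?thesis
    using b c B(2) by (metis card_Suc_Diff1 finite_Diff2 finite.emptyI finite.insertI)
qed

lemma affine_independent_insert_notin_hull:
  fixes B :: "'a::real_vector set"
  assumes B: "\<not> affine_dependent B" and w: "w \<notin> affine hull B"
  shows "\<not> affine_dependent (insert w B)"
proof (cases "B = {}")
  case True
  then show ?thesis by simp
next
  case False
  then obtain b where b: "b \<in> B" by auto
  let ?B = "(\<lambda>x. - b + x) ` (B - {b})"
  have "w \<noteq> b" using w b by (auto simp: hull_inc)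
  have hull: "affine hull B = (\<lambda>x. b + x) ` span ?B"
    using affine_hull_insert_span_gen[of b "B - {b}"] b by (simp add: insert_absorb)
  have "- b + w \<notin> span ?B"
    using w unfolding hull by (metis add_minus_cancel image_eqI)
  moreover have "independent ?B"
    using B b affine_dependent_iff_dependent2 by blast
  ultimately have "independent (insert (- b + w) ?B)"
    by (simp add: independent_insert)
  also have "insert (- b + w) ?B = (\<lambda>x. - b + x) ` (insert w B - {b})"
    using \<open>w \<noteq> b\<close> by auto
  finally show ?thesis
    using affine_dependent_iff_dependent2[of b "insert w B"] b by blast
qed

lemma affine_dim_eqI:
  assumes "\<not> affine_dependent B" "finite B" "affine hull B = affine hull V"
  shows "affine_dim V = int (card B) - 1"
  unfolding affine_dim_def
proof (rule some_equality)
  show "\<exists>B'. affine hull B' = affine hull V \<and> \<not> affine_dependent B' \<and> int (card B') = int (card B) - 1 + 1"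
    using assms by auto
next
  fix d assume "\<exists>B'. affine hull B' = affine hull V \<and> \<not> affine_dependent B' \<and> int (card B') = d + 1"
  then show "d = int (card B) - 1"
    using card_affine_basis_unique[OF assms(1,2)] assms(3) by force
qed

text \<open>
  If \<open>v\<close> has positive weight in a convex combination \<open>x \<in> F\<close> of \<open>V\<close>, then \<open>x\<close> lies strictly between \<open>v\<close>
  and the normalized combination of the other points, unless all of these coincide; hence \<open>v \<in> F\<close>. So
  a face is determined by the points of \<open>V\<close> it contains, and there are finitely many faces.
\<close>
lemma face_subset_hull_vertices:
  assumes V: "finite V" and F: "F face_of convex hull V"
  shows "F = convex hull (F \<inter> V)"
proof
  show "convex hull (F \<inter> V) \<subseteq> F"
    using F by (intro hull_minimal) (auto simp: face_of_def)
  show "F \<subseteq> convex hull (F \<inter> V)"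
  proof
    fix x assume x: "x \<in> F"
    then have "x \<in> convex hull V" using F by (auto simp: face_of_def)
    then obtain u where u: "\<And>v. v \<in> V \<Longrightarrow> 0 \<le> u v" "sum u V = 1" "(\<Sum>v\<in>V. u v *\<^sub>R v) = x"
      unfolding convex_hull_finite[OF V] by auto
    have in_F: "v \<in> F" if v: "v \<in> V" "u v > 0" for v
    proof (cases "u v = 1")
      case True
      have "sum u (V - {v}) = 0"
        using u(2) V v True by (simp add: sum_diff1)
      then have "u w = 0" if "w \<in> V - {v}" for w
        using that V u(1) by (subst (asm) sum_nonneg_eq_0_iff) auto
      then have "x = v"
        using u(3) V v True by (simp add: sum.remove[of V v])
      then show ?thesis using x by simp
    next
      case False
      define s where "s = 1 - u v"
      have rest: "sum u (V - {v}) = s"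
        using u(2) V v by (simp add: sum_diff1 s_def)
      moreover have "0 \<le> sum u (V - {v})"
        using u(1) by (intro sum_nonneg) auto
      ultimately have s: "0 < s" "s < 1"
        using False v by (auto simp: s_def)
      define w where "w = (\<Sum>y\<in>V - {v}. (u y / s) *\<^sub>R y)"
      have "(\<Sum>y\<in>V - {v}. (u y / s) *\<^sub>R y) \<in> convex hull V"
        using V u(1) s rest
        by (intro convex_sum) (auto simp: hull_inc simp flip: sum_divide_distrib)
      then have w: "w \<in> convex hull V" by (simp add: w_def)
      have xw: "x = (1 - s) *\<^sub>R v + s *\<^sub>R w"
        using s u(3) V v by (simp add: w_def scaleR_sum_right sum.remove[of V v] s_def)
      show ?thesis
      proof (cases "v = w")
        case True
        then show ?thesis using xw x by (simp flip: scaleR_left_distrib)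
      next
        case False
        then have "x \<in> open_segment v w"
          using s xw by (auto simp: in_segment)
        then show ?thesis
          using face_ofD[OF F _ _ w x] v(1) by (simp add: hull_inc)
      qed
    qed
    have "x = (\<Sum>v\<in>F \<inter> V. u v *\<^sub>R v)"
      unfolding u(3)[symmetric] using V u(1) in_F
      by (intro sum.mono_neutral_right) (auto simp: less_le)
    moreover have "sum u (F \<inter> V) = 1"
      unfolding u(2)[symmetric] using V u(1) in_F
      by (intro sum.mono_neutral_left) (auto simp: less_le)
    ultimately show "x \<in> convex hull (F \<inter> V)"
      using V u(1) by (auto intro!: convex_sum simp: hull_inc)
  qed
qed

lemma finite_facets:
  assumes "finite V"
  shows "finite (facets (convex hull V))"
proof (rule finite_subset)
  show "facets (convex hull V) \<subseteq> (hull) convex ` Pow V"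
  proof
    fix F assume "F \<in> facets (convex hull V)"
    then have "F = convex hull (F \<inter> V)"
      by (intro face_subset_hull_vertices[OF assms]) (simp add: facets_def)
    then show "F \<in> (hull) convex ` Pow V"
      by blast
  qed
qed (use assms in auto)

lemma exposed_face:
  assumes V: "finite V" and h: "affine_functional h" and nn: "\<And>v. v \<in> V \<Longrightarrow> 0 \<le> h v"
  shows "{x \<in> convex hull V. h x = 0} face_of convex hull V"
  unfolding face_of_def
proof (intro conjI ballI impI)
  have pos: "0 \<le> h x" if "x \<in> convex hull V" for x
    using affine_functional_nonneg_hull[OF h nn that] .
  show "convex {x \<in> convex hull V. h x = 0}"
    by (subst convex_alt)
       (auto simp: affine_functional_combine[OF h] intro: convexD_alt[OF convex_convex_hull])
  fix a b x assume ab: "a \<in> convex hull V" "b \<in> convex hull V"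
    and x: "x \<in> {x \<in> convex hull V. h x = 0}" "x \<in> open_segment a b"
  obtain u where u: "0 < u" "u < 1" "x = (1 - u) *\<^sub>R a + u *\<^sub>R b"
    using x(2) by (auto simp: in_segment)
  have "(1 - u) * h a + u * h b = 0"
    using x(1) affine_functional_combine[OF h, of u a b] by (simp add: u(3))
  moreover have "0 \<le> (1 - u) * h a" "0 \<le> u * h b"
    using pos[OF ab(1)] pos[OF ab(2)] u by auto
  ultimately have "(1 - u) * h a = 0" "u * h b = 0"
    by linarith+
  then have "h a = 0" "h b = 0"
    using u by auto
  then show "a \<in> {x \<in> convex hull V. h x = 0}" "b \<in> {x \<in> convex hull V. h x = 0}"
    using ab by auto
qed auto

text \<open>
  The assumption \<open>proportional\<close> says that the zero set of \<open>h\<close> spans a hyperplane of the affine hull of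
  \<open>V\<close>: if adding the single point \<open>v0\<close> to it did not span everything, some functional would vanish on
  both without vanishing on \<open>V\<close>, hence without being a multiple of \<open>h\<close>. So \<open>v0\<close> extends an affine
  basis of the face to one of the polytope.
\<close>
lemma exposed_facetI:
  assumes V: "finite V" and h: "affine_functional h" and nn: "\<And>v. v \<in> V \<Longrightarrow> 0 \<le> h v"
    and z: "z \<in> V" "h z = 0" and v0: "v0 \<in> V" "h v0 > 0"
    and proportional: "\<And>l. affine_functional l \<Longrightarrow> (\<And>v. v \<in> V \<Longrightarrow> h v = 0 \<Longrightarrow> l v = 0) \<Longrightarrow>
                 \<exists>c. \<forall>v\<in>V. l v = c * h v"
  shows "{x \<in> convex hull V. h x = 0} \<in> facets (convex hull V)"
proof -
  define F where "F = {x \<in> convex hull V. h x = 0}"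
  define Z where "Z = {v \<in> V. h v = 0}"
  have F: "F face_of convex hull V"
    unfolding F_def by (rule exposed_face[OF V h nn])
  have "F \<inter> V = Z"
    by (auto simp: F_def Z_def hull_inc)
  then have FZ: "F = convex hull Z"
    using face_subset_hull_vertices[OF V F] by simp
  obtain B where B: "B \<subseteq> Z" "\<not> affine_dependent B" "affine hull Z = affine hull B"
    using affine_basis_exists by blast
  have finB: "finite B"
    using B(1) V by (auto simp: Z_def intro: finite_subset)
  have v0B: "v0 \<notin> affine hull B"
    using affine_functional_zero_hull[OF h, of Z v0] v0 B(3) by (auto simp: Z_def)
  have indep: "\<not> affine_dependent (insert v0 B)"
    using affine_independent_insert_notin_hull[OF B(2) v0B] .
  have "v \<in> affine hull (insert v0 B)" if v: "v \<in> V" for v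
  proof (rule ccontr)
    assume notin: "v \<notin> affine hull (insert v0 B)"
    obtain l where l: "affine_functional l" "\<And>x. x \<in> insert v0 B \<Longrightarrow> l x = 0" "l v = 1"
      by (rule affine_functional_separates[OF insert_not_empty notin]) (rule that)
    have "l x = 0" if x: "x \<in> V" "h x = 0" for x
    proof (rule affine_functional_zero_hull[OF l(1)])
      show "x \<in> affine hull B"
        unfolding B(3)[symmetric] using x by (intro hull_inc) (simp add: Z_def)
      show "l y = 0" if "y \<in> B" for y
        using l(2)[of y] that by simp
    qed
    then have "\<exists>c. \<forall>v\<in>V. l v = c * h v"
      by (intro proportional[OF l(1)])
    then obtain c where c: "\<forall>v\<in>V. l v = c * h v" ..
    have "c * h v0 = 0"
      using l(2)[of v0] c v0(1) by simp
    then have "c = 0"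
      using v0(2) by simp
    then show False
      using c v l(3) by simp
  qed
  then have "affine hull V \<subseteq> affine hull (insert v0 B)"
    by (intro hull_minimal) auto
  moreover have "affine hull (insert v0 B) \<subseteq> affine hull V"
    using B(1) v0 by (intro hull_mono) (auto simp: Z_def)
  ultimately have "affine_dim (convex hull V) = int (card (insert v0 B)) - 1"
    using indep finB by (intro affine_dim_eqI) (auto simp: affine_hull_convex_hull)
  moreover have "affine_dim F = int (card B) - 1"
    using B finB by (intro affine_dim_eqI) (auto simp: FZ affine_hull_convex_hull)
  moreover have "v0 \<notin> B"
    using v0B by (auto simp: hull_inc)
  moreover have "z \<in> F"
    using z by (simp add: F_def hull_inc)
  ultimately show ?thesis
    using F finB unfolding F_def[symmetric] by (auto simp: facets_def)
qed

text \<open>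
  The largest multiple \<open>t\<close> of \<open>h\<close> that can be subtracted from \<open>g\<close> keeping it nonnegative on \<open>V\<close>; at
  the minimizer \<open>w\<close> of the ratio \<open>g / h\<close> the difference acquires a new zero. Since \<open>g\<close> is positive
  wherever \<open>h\<close> is, \<open>t\<close> is positive and \<open>w\<close> was not a zero of \<open>g\<close>.
\<close>
lemma ratio_test:
  fixes g h :: "'a \<Rightarrow> real"
  assumes V: "finite V" and pos: "\<And>v. v \<in> V \<Longrightarrow> 0 < h v \<Longrightarrow> 0 < g v" and nn: "\<And>v. v \<in> V \<Longrightarrow> 0 \<le> g v"
    and v: "v \<in> V" "0 < h v"
  obtains t w where "0 < t" "w \<in> V" "0 < h w" "g w = t * h w" "\<And>v. v \<in> V \<Longrightarrow> t * h v \<le> g v"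
proof -
  let ?W = "{v \<in> V. 0 < h v}"
  let ?r = "\<lambda>v. g v / h v"
  define w where "w = arg_min_on ?r ?W"
  have "finite ?W" "?W \<noteq> {}"
    using V v by auto
  then have w: "w \<in> ?W" "\<And>v. v \<in> ?W \<Longrightarrow> ?r w \<le> ?r v"
    unfolding w_def by (rule arg_min_if_finite(1), rule arg_min_least)
  show thesis
  proof (rule that[of "g w / h w" w])
    show "g w / h w * h v \<le> g v" if "v \<in> V" for v
    proof (cases "0 < h v")
      case True
      then show ?thesis using w(2)[of v] that by (simp add: pos_le_divide_eq)
    next
      case False
      then have "g w / h w * h v \<le> 0"
        using w(1) nn by (intro mult_nonneg_nonpos) auto
      then show ?thesis using nn[OF that] by linarith
    qed
  next
    show "0 < g w / h w" "w \<in> V" "0 < h w" "g w = g w / h w * h w"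
      using w(1) pos[of w] by auto
  qed
qed

text \<open>
  Among the nonzero functionals that are nonnegative on \<open>V\<close> and vanish wherever \<open>g\<close> does, choose one
  with as many zeros in \<open>V\<close> as possible. If some \<open>l\<close> vanished wherever \<open>h\<close> does without being
  proportional to it, subtracting a suitable multiple of \<open>l\<close> or \<open>-l\<close> from \<open>h\<close> would produce a functional
  with more zeros. So the zero set of \<open>h\<close> is a facet.
\<close>
lemma exists_facet_containing:
  assumes V: "finite V" and g: "affine_functional g" and nn: "\<And>v. v \<in> V \<Longrightarrow> 0 \<le> g v"
    and z: "z \<in> V" "g z = 0" and v0: "v0 \<in> V" "g v0 \<noteq> 0"
  obtains h where "affine_functional h" "\<And>v. v \<in> V \<Longrightarrow> 0 \<le> h v"
    "\<And>v. v \<in> V \<Longrightarrow> g v = 0 \<Longrightarrow> h v = 0" "{x \<in> convex hull V. h x = 0} \<in> facets (convex hull V)"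
    "\<exists>v\<in>V. 0 < h v"
proof -
  define Z :: "('a \<Rightarrow> real) \<Rightarrow> 'a set" where "Z h = {v \<in> V. h v = 0}" for h
  define P where "P h \<longleftrightarrow> affine_functional h \<and> (\<forall>v\<in>V. 0 \<le> h v) \<and> Z g \<subseteq> Z h \<and> (\<exists>v\<in>V. 0 < h v)" for h
  have "P g"
    using g nn v0 by (auto simp: P_def less_le)
  moreover have "card (Z h) < Suc (card V)" for h
    using V by (auto simp: Z_def less_Suc_eq_le intro!: card_mono)
  ultimately obtain h where h: "P h" "\<And>k. P k \<Longrightarrow> card (Z k) \<le> card (Z h)"
    using ex_has_greatest_nat[of P g "\<lambda>h. card (Z h)" "Suc (card V)"] by (metis less_imp_le)
  have ha: "affine_functional h" and hn: "\<And>v. v \<in> V \<Longrightarrow> 0 \<le> h v" and hz: "Z g \<subseteq> Z h"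
    using h(1) by (auto simp: P_def)
  obtain v1 where v1: "v1 \<in> V" "0 < h v1"
    using h(1) by (auto simp: P_def)
  have max: False
    if k: "affine_functional k" "\<And>v. v \<in> V \<Longrightarrow> 0 \<le> k v" "\<And>v. v \<in> V \<Longrightarrow> h v = 0 \<Longrightarrow> k v = 0"
      "w \<in> V" "0 < h w" "k w = 0" "v \<in> V" "k v \<noteq> 0" for k v w
  proof -
    have "P k"
      using k hz by (auto simp: P_def Z_def less_le)
    moreover have "Z h \<subseteq> Z k" "w \<in> Z k" "w \<notin> Z h"
      using k by (auto simp: Z_def)
    then have "Z h \<subset> Z k" by blast
    then have "card (Z h) < card (Z k)"
      using V by (intro psubset_card_mono) (auto simp: Z_def)
    ultimately show False using h(2)[of k] by simp
  qed
  have one_sided: "\<exists>c. \<forall>v\<in>V. l v = c * h v"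
    if l: "affine_functional l" "\<And>v. v \<in> V \<Longrightarrow> h v = 0 \<Longrightarrow> l v = 0" and u: "u \<in> V" "0 < l u" for l u
  proof -
    have pos: "0 < h v" if "v \<in> V" "0 < l v" for v
      using l(2)[OF that(1)] hn[OF that(1)] that(2) by (cases "h v = 0") auto
    obtain t w where t: "0 < t" "w \<in> V" "0 < l w" "h w = t * l w" "\<And>v. v \<in> V \<Longrightarrow> t * l v \<le> h v"
      by (rule ratio_test[of V l h, OF V pos hn u]) (assumption | rule that | blast)+
    define k where "k = (\<lambda>x. h x + (- t) * l x)"
    have k: "affine_functional k"
      unfolding k_def by (rule affine_functional_add[OF ha l(1)])
    have k_V: "\<And>v. v \<in> V \<Longrightarrow> 0 \<le> k v" "\<And>v. v \<in> V \<Longrightarrow> h v = 0 \<Longrightarrow> k v = 0" "k w = 0"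
      using t l(2) by (auto simp: k_def)
    have "0 < h w"
      using t by simp
    then have "k v = 0" if "v \<in> V" for v
      using max[OF k k_V(1,2) t(2) _ k_V(3) that] by blast
    then have "\<forall>v\<in>V. l v = (1 / t) * h v"
      using t(1) by (simp add: k_def field_simps)
    then show ?thesis ..
  qed
  have "\<exists>c. \<forall>v\<in>V. l v = c * h v"
    if l: "affine_functional l" "\<And>v. v \<in> V \<Longrightarrow> h v = 0 \<Longrightarrow> l v = 0" for l
  proof (cases "\<forall>v\<in>V. l v = 0")
    case True
    then show ?thesis by (intro exI[of _ 0]) auto
  next
    case False
    then obtain u where "u \<in> V" "l u \<noteq> 0" by auto
    then consider "0 < l u" | "0 < (\<lambda>x. 0 + (- 1) * l x) u"
      by fastforce
    then show ?thesis
    proof cases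
      case 1
      then show ?thesis using one_sided[OF l] \<open>u \<in> V\<close> by blast
    next
      case 2
      have "affine_functional (\<lambda>x. 0 + (- 1) * l x)"
        using affine_functional_linear_add[OF linear_zero, of 0]
        by (intro affine_functional_add l) simp
      then obtain c where "\<forall>v\<in>V. 0 + (- 1) * l v = c * h v"
        using one_sided[of "\<lambda>x. 0 + (- 1) * l x" u] l(2) 2 \<open>u \<in> V\<close> by auto
      then show ?thesis by (intro exI[of _ "- c"]) auto
    qed
  qed
  moreover have "h z = 0"
    using hz z by (auto simp: Z_def)
  ultimately have "{x \<in> convex hull V. h x = 0} \<in> facets (convex hull V)"
    using exposed_facetI[OF V ha hn z(1) _ v1] by metis
  moreover have "h v = 0" if "v \<in> V" "g v = 0" for v
    using hz that by (auto simp: Z_def)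
  ultimately show thesis
    using v1 by (intro that[OF ha hn]) auto
qed

text \<open>
  The functional exposing a facet is unique up to a positive multiple on \<open>Q\<close>; one is fixed for each
  facet, so that it can be shared by all functionals that are decomposed. The default \<open>0\<close> makes it
  nonnegative on \<open>Q\<close> for every argument.
\<close>
definition facet_functional :: "'a::real_vector set \<Rightarrow> 'a set \<Rightarrow> 'a \<Rightarrow> real" where
  "facet_functional Q F =
     (if \<exists>h. affine_functional h \<and> (\<forall>x\<in>Q. 0 \<le> h x) \<and> {x \<in> Q. h x = 0} = F
      then SOME h. affine_functional h \<and> (\<forall>x\<in>Q. 0 \<le> h x) \<and> {x \<in> Q. h x = 0} = F else (\<lambda>_. 0))"

lemma facet_functional_props:
  assumes "affine_functional h" "\<And>x. x \<in> Q \<Longrightarrow> 0 \<le> h x"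
  defines "k \<equiv> facet_functional Q {x \<in> Q. h x = 0}"
  shows "affine_functional k" "{x \<in> Q. k x = 0} = {x \<in> Q. h x = 0}"
proof -
  let ?P = "\<lambda>k. affine_functional k \<and> (\<forall>x\<in>Q. 0 \<le> k x) \<and> {x \<in> Q. k x = 0} = {x \<in> Q. h x = 0}"
  have ex: "\<exists>k. ?P k" using assms(1,2) by blast
  then have "k = (SOME k. ?P k)"
    by (simp add: k_def facet_functional_def)
  then have "?P k"
    using someI_ex[OF ex] by simp
  then show "affine_functional k" "{x \<in> Q. k x = 0} = {x \<in> Q. h x = 0}"
    by auto
qed

lemma facet_functional_nonneg: "x \<in> Q \<Longrightarrow> 0 \<le> facet_functional Q F x"
proof -
  assume x: "x \<in> Q"
  let ?P = "\<lambda>k. affine_functional k \<and> (\<forall>x\<in>Q. 0 \<le> k x) \<and> {x \<in> Q. k x = 0} = F"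
  show ?thesis
  proof (cases "\<exists>k. ?P k")
    case True
    then have "facet_functional Q F = (SOME k. ?P k)"
      by (simp add: facet_functional_def)
    then show ?thesis using someI_ex[OF True] x by simp
  next
    case False
    then have "facet_functional Q F = (\<lambda>_. 0)"
      unfolding facet_functional_def by (rule if_not_P)
    then show ?thesis by simp
  qed
qed

text \<open>
  Every functional \<open>g\<close> that is nonnegative on \<open>V\<close> with a zero there is reduced to \<open>0\<close> by
  repeatedly subtracting facet functionals: take a facet containing all zeros of \<open>g\<close> and subtract the
  largest multiple of its functional that keeps the difference nonnegative. The old zeros persist and a new
  one appears, so the process ends.
\<close>
lemma nonneg_functional_facet_combination_zero:
  fixes V :: "'a::real_vector set"
  assumes V: "finite V"
  defines "Q \<equiv> convex hull V"
  shows "affine_functional g \<Longrightarrow> (\<And>v. v \<in> V \<Longrightarrow> 0 \<le> g v) \<Longrightarrow> z \<in> V \<Longrightarrow> g z = 0 \<Longrightarrow>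
    \<exists>\<mu>. (\<forall>F. 0 \<le> \<mu> F) \<and> (\<forall>x\<in>Q. g x = (\<Sum>F\<in>facets Q. \<mu> F * facet_functional Q F x))"
proof (induction "card {v \<in> V. g v \<noteq> 0}" arbitrary: g rule: less_induct)
  case less
  show ?case
  proof (cases "\<exists>v0\<in>V. g v0 \<noteq> 0")
    case False
    have "g x = 0" if "x \<in> Q" for x
    proof (rule affine_functional_zero_hull[OF less.prems(1)])
      show "x \<in> affine hull V"
        using that convex_hull_subset_affine_hull[of V] unfolding Q_def by blast
      show "g v = 0" if "v \<in> V" for v
        using False that by blast
    qed
    then show ?thesis by (intro exI[of _ "\<lambda>_. 0"]) auto
  next
    case True
    then obtain v0 where v0: "v0 \<in> V" "g v0 \<noteq> 0" by blast
    obtain h where h: "affine_functional h" "\<And>v. v \<in> V \<Longrightarrow> 0 \<le> h v"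
      "\<And>v. v \<in> V \<Longrightarrow> g v = 0 \<Longrightarrow> h v = 0" "{x \<in> Q. h x = 0} \<in> facets Q" "\<exists>v\<in>V. 0 < h v"
      unfolding Q_def by (rule exists_facet_containing[OF V less.prems v0]) (assumption | rule that[unfolded Q_def] | blast)+
    have VQ: "v \<in> Q" if "v \<in> V" for v
      using that by (simp add: Q_def hull_inc)
    define F where "F = {x \<in> Q. h x = 0}"
    define k where "k = facet_functional Q F"
    have k: "affine_functional k" "{x \<in> Q. k x = 0} = F"
      using facet_functional_props[of h Q] affine_functional_nonneg_hull[OF h(1,2)] h(1)
      by (auto simp: k_def F_def Q_def)
    have kn: "0 \<le> k x" if "x \<in> Q" for x
      unfolding k_def by (rule facet_functional_nonneg[OF that])
    have k0: "k v = 0 \<longleftrightarrow> h v = 0" if "v \<in> V" for v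
      using k(2) VQ[OF that] by (auto simp: F_def)
    obtain v1 where v1: "v1 \<in> V" "0 < k v1"
      using h(5) k0 kn VQ by (metis less_le)
    have pos: "0 < g v" if "v \<in> V" "0 < k v" for v
      using that h(3)[OF that(1)] k0[OF that(1)] less.prems(2)[OF that(1)] by (auto simp: less_le)
    obtain t w where t: "0 < t" "w \<in> V" "0 < k w" "g w = t * k w" "\<And>v. v \<in> V \<Longrightarrow> t * k v \<le> g v"
      by (rule ratio_test[of V k g, OF V pos less.prems(2) v1]) (assumption | rule that | blast)+
    define g' where "g' = (\<lambda>x. g x + (- t) * k x)"
    have zeros: "g' v = 0" if "v \<in> V" "g v = 0" for v
      using h(3)[OF that] k0[OF that(1)] that by (simp add: g'_def)
    have "{v \<in> V. g' v \<noteq> 0} \<subset> {v \<in> V. g v \<noteq> 0}"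
      using zeros t by (auto simp: g'_def)
    then have "card {v \<in> V. g' v \<noteq> 0} < card {v \<in> V. g v \<noteq> 0}"
      using V by (intro psubset_card_mono) auto
    moreover have "affine_functional g'"
      unfolding g'_def by (intro affine_functional_add less.prems k)
    moreover have "0 \<le> g' v" if "v \<in> V" for v
      using t(5)[OF that] by (simp add: g'_def)
    moreover have "g' z = 0"
      using zeros less.prems by blast
    ultimately obtain \<mu> where \<mu>: "\<forall>F. 0 \<le> \<mu> F"
      "\<forall>x\<in>Q. g' x = (\<Sum>F\<in>facets Q. \<mu> F * facet_functional Q F x)"
      using less.hyps[of g'] less.prems(3) by blast
    have "g x = (\<Sum>G\<in>facets Q. (\<mu> G + (if G = F then t else 0)) * facet_functional Q G x)"
      if "x \<in> Q" for x
    proof -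
      have "(\<Sum>G\<in>facets Q. (if G = F then t else 0) * facet_functional Q G x)
          = (\<Sum>G\<in>facets Q. if G = F then t * k x else 0)"
        by (intro sum.cong) (auto simp: k_def)
      also have "\<dots> = t * k x"
        using h(4) finite_facets[OF V] by (simp add: F_def Q_def)
      finally show ?thesis
        using \<mu>(2) that by (simp add: g'_def distrib_right sum.distrib algebra_simps)
    qed
    then show ?thesis
      using \<mu>(1) t(1) by (intro exI[of _ "\<lambda>G. \<mu> G + (if G = F then t else 0)"]) auto
  qed
qed

text \<open>
  The affine form of Farkas' lemma for the facet description of a polytope; the constant \<open>c\<close> is the
  minimum of \<open>g\<close>.
\<close>
lemma nonneg_functional_facet_combination:
  fixes Q :: "'a::real_vector set"
  assumes Q: "polytope Q" "Q \<noteq> {}" and g: "affine_functional g" and nn: "\<And>x. x \<in> Q \<Longrightarrow> 0 \<le> g x"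
  obtains \<mu> c where "\<And>F. 0 \<le> \<mu> F" "0 \<le> c"
    "\<And>x. x \<in> Q \<Longrightarrow> g x = (\<Sum>F\<in>facets Q. \<mu> F * facet_functional Q F x) + c"
proof -
  obtain V where V: "finite V" "Q = convex hull V"
    using Q by (auto simp: polytope_def)
  have "V \<noteq> {}" using Q V by auto
  define c where "c = Min (g ` V)"
  have "c \<in> g ` V"
    using V \<open>V \<noteq> {}\<close> by (auto simp: c_def intro!: Min_in)
  then obtain z where z: "z \<in> V" "g z = c"
    by auto
  have le: "c \<le> g v" if "v \<in> V" for v
    using that V by (simp add: c_def)
  have "affine_functional (\<lambda>x. 0 + - c)"
    using affine_functional_linear_add[OF linear_zero] by metis
  then have "affine_functional (\<lambda>x. g x + 1 * - c)"
    using affine_functional_add[OF g, of "\<lambda>x. - c" 1] by simp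
  then have "affine_functional (\<lambda>x. g x - c)"
    by simp
  moreover have "0 \<le> g v - c" if "v \<in> V" for v
    using le[OF that] by simp
  moreover have "g z - c = 0"
    using z by simp
  ultimately have "\<exists>\<mu>. (\<forall>F. 0 \<le> \<mu> F) \<and>
      (\<forall>x\<in>Q. g x - c = (\<Sum>F\<in>facets Q. \<mu> F * facet_functional Q F x))"
    using nonneg_functional_facet_combination_zero[OF V(1), of "\<lambda>x. g x - c" z, folded V(2)] z(1)
    by blast
  then obtain \<mu> where \<mu>: "\<And>F. 0 \<le> \<mu> F"
    "\<And>x. x \<in> Q \<Longrightarrow> g x - c = (\<Sum>F\<in>facets Q. \<mu> F * facet_functional Q F x)"
    by blast
  have "z \<in> Q"
    using z(1) V(2) by (simp add: hull_inc)
  then have "0 \<le> c"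
    using nn[of z] z(2) by simp
  then show thesis
    using \<mu> by (intro that[of \<mu> c]) (auto simp flip: \<mu>(2))
qed

section \<open>Extended formulations and the spectraplex\<close>

lemma lookup_scaleR [simp]:
  "Poly_Mapping.lookup (r *\<^sub>R x) i = r *\<^sub>R Poly_Mapping.lookup x i"
proof -
  have "finite {i. r *\<^sub>R Poly_Mapping.lookup x i \<noteq> 0}"
    by (rule finite_subset[OF _ finite_lookup[of x]]) auto
  then show ?thesis
    by (simp add: scaleR_poly_mapping_def)
qed

text \<open>
  A polytope with \<open>m\<close> given vertices is the image of a simplex in \<open>coord_space m\<close>, so the minimum in
  the definition is taken over a nonempty set.
\<close>
lemma extension_complexity_attained:
  fixes P :: "'a::real_vector set"
  assumes "polytope P"
  obtains Q and f :: "(nat, real) poly_mapping \<Rightarrow> 'a"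
  where "polytope Q" "card (facets Q) = extension_complexity P" "linear f" "P = f ` Q"
proof -
  let ?R = "\<lambda>k. \<exists>m Q (f :: (nat, real) poly_mapping \<Rightarrow> 'a).
        Q \<subseteq> coord_space m \<and> polytope Q \<and> card (facets Q) = k \<and> linear f \<and> P = f ` Q"
  obtain V where V: "finite V" "P = convex hull V"
    using assms by (auto simp: polytope_def)
  obtain e :: "nat \<Rightarrow> 'a" and m where e: "V = e ` {..<m}"
    using finite_imp_nat_seg_image_inj_on[OF V(1)] by (metis lessThan_def)
  define E where "E = (\<lambda>i. Poly_Mapping.single i (1::real)) ` {..<m}"
  define f :: "(nat, real) poly_mapping \<Rightarrow> 'a" where "f u = (\<Sum>i<m. Poly_Mapping.lookup u i *\<^sub>R e i)" for u
  have f: "linear f"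
    by (rule linearI) (auto simp: f_def lookup_add scaleR_left_distrib sum.distrib scaleR_sum_right)
  have "f (Poly_Mapping.single i 1) = e i" if "i < m" for i
  proof -
    have "f (Poly_Mapping.single i 1) = (\<Sum>j<m. if i = j then e j else 0)"
      unfolding f_def by (intro sum.cong) (auto simp: lookup_single)
    then show ?thesis using that by simp
  qed
  then have "f ` E = V"
    by (force simp: E_def e image_image)
  then have "P = f ` (convex hull E)"
    using convex_hull_linear_image[OF f] V(2) by metis
  moreover have "convex hull E \<subseteq> coord_space m"
  proof (rule hull_minimal)
    have "coord_space m = {u. \<forall>i\<ge>m. Poly_Mapping.lookup u i = 0}"
      by (auto simp: coord_space_def in_keys_iff subset_iff not_less[symmetric])
    then show "convex (coord_space m)"
      by (auto simp: convex_def lookup_add)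
  qed (auto simp: E_def coord_space_def)
  moreover have "polytope (convex hull E)"
    by (auto simp: polytope_def E_def)
  ultimately have "?R (card (facets (convex hull E)))"
    using f by blast
  then have "?R (extension_complexity P)"
    unfolding extension_complexity_def by (rule LeastI)
  then show thesis
    using that by blast
qed

lemma affine_functional_compose_linear:
  assumes "affine_functional l" "linear f"
  shows "affine_functional (\<lambda>x. l (f x) + c)"
proof -
  obtain \<phi> d where "linear \<phi>" "l = (\<lambda>x. \<phi> x + d)"
    using assms by (auto simp: affine_functional_def)
  then show ?thesis
    using affine_functional_linear_add[OF linear_compose[OF assms(2), of \<phi>], of "d + c"]
    by (simp add: o_def add.assoc)
qed

text \<open>
  With at most one facet, every functional that is nonnegative on \<open>Q\<close> is a constant plus a nonnegative
  multiple of one fixed \<open>h\<close>. A functional separating \<open>p\<close> and \<open>q\<close>, shifted by a large constant \<open>M\<close>, and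
  its negative shifted in the same way would both have this form, although one increases and the other
  decreases from \<open>p\<close> to \<open>q\<close>.
\<close>
lemma two_le_card_facets:
  fixes f :: "'a::real_vector \<Rightarrow> 'b::real_vector"
  assumes Q: "polytope Q" and f: "linear f" and pq: "p \<in> f ` Q" "q \<in> f ` Q" "p \<noteq> q"
  shows "2 \<le> card (facets Q)"
proof (rule ccontr)
  assume "\<not> 2 \<le> card (facets Q)"
  obtain V where V: "finite V" "Q = convex hull V"
    using Q by (auto simp: polytope_def)
  have "finite (facets Q)"
    unfolding V(2) by (rule finite_facets[OF V(1)])
  moreover have "card (facets Q) = 0 \<or> card (facets Q) = 1"
    using \<open>\<not> 2 \<le> card (facets Q)\<close> by linarith
  ultimately consider "facets Q = {}" | F where "facets Q = {F}"
    by (auto simp: card_1_singleton_iff)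
  then obtain h where h: "\<And>\<mu>. \<exists>a\<ge>(0::real). (\<forall>F. 0 \<le> \<mu> F) \<longrightarrow>
      (\<forall>x. (\<Sum>F\<in>facets Q. \<mu> F * facet_functional Q F x) = a * h x)"
  proof cases
    case 1
    then show thesis by (intro that[of "\<lambda>_. 0"]) auto
  next
    case (2 F)
    have "\<exists>a\<ge>0. (\<forall>F. 0 \<le> \<mu> F) \<longrightarrow>
      (\<forall>x. (\<Sum>F\<in>facets Q. \<mu> F * facet_functional Q F x) = a * facet_functional Q F x)" for \<mu> :: "_ \<Rightarrow> real"
      using 2 by (intro exI[of _ "\<bar>\<mu> F\<bar>"]) auto
    then show thesis by (rule that)
  qed
  have "q \<notin> affine hull {p}"
    using pq(3) by (simp add: hull_same)
  then obtain l where l: "affine_functional l" "l p = 0" "l q = 1"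
    using affine_functional_separates[of "{p}" q] by auto
  obtain u v where uv: "u \<in> Q" "p = f u" "v \<in> Q" "q = f v"
    using pq by auto
  define M where "M = (\<Sum>v\<in>V. \<bar>l (f v)\<bar>)"
  have M: "\<bar>l (f v)\<bar> \<le> M" if "v \<in> V" for v
    unfolding M_def using that V(1) by (intro member_le_sum) auto
  have "Q \<noteq> {}" using uv by auto
  have aff: "affine_functional (\<lambda>x. l (f x) + M)" "affine_functional (\<lambda>x. M + (- 1) * l (f x))"
  proof -
    show "affine_functional (\<lambda>x. l (f x) + M)"
      by (rule affine_functional_compose_linear[OF l(1) f])
    have "affine_functional (\<lambda>x::'a. 0 + M)"
      by (rule affine_functional_linear_add[OF linear_zero])
    moreover have "affine_functional (\<lambda>x. l (f x) + 0)"
      by (rule affine_functional_compose_linear[OF l(1) f])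
    ultimately show "affine_functional (\<lambda>x. M + (- 1) * l (f x))"
      using affine_functional_add[of "\<lambda>x. 0 + M" "\<lambda>x. l (f x) + 0" "- 1"] by simp
  qed
  have slope: "\<exists>a\<ge>0. g v - g u = a * (h v - h u)"
    if g: "affine_functional g" "\<And>v. v \<in> V \<Longrightarrow> 0 \<le> g v" for g
  proof -
    have "0 \<le> g x" if "x \<in> Q" for x
      using affine_functional_nonneg_hull[OF g] that V(2) by simp
    then obtain \<mu> c where *: "\<And>F. 0 \<le> \<mu> F"
      "\<And>x. x \<in> Q \<Longrightarrow> g x = (\<Sum>F\<in>facets Q. \<mu> F * facet_functional Q F x) + c"
      using nonneg_functional_facet_combination[OF Q \<open>Q \<noteq> {}\<close> g(1)] by metis
    obtain a where "a \<ge> 0" "\<And>x. (\<Sum>F\<in>facets Q. \<mu> F * facet_functional Q F x) = a * h x"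
      using h[of \<mu>] *(1) by blast
    then show ?thesis
      using *(2) uv by (auto simp: algebra_simps intro!: exI[of _ a])
  qed
  obtain a where a: "0 \<le> a" "1 = a * (h v - h u)"
    using slope[OF aff(1)] M l uv by force
  obtain b where b: "0 \<le> b" "- 1 = b * (h v - h u)"
    using slope[OF aff(2)] M l uv by force
  have "0 < h v - h u"
    using a by (metis zero_less_mult_pos zero_less_one less_le mult_zero_left zero_neq_one)
  then have "0 \<le> b * (h v - h u)"
    using b(1) by simp
  then show False
    using b(2) by linarith
qed

definition quad_form :: "nat \<Rightarrow> rmat \<Rightarrow> (nat \<Rightarrow> real) \<Rightarrow> real" where
  "quad_form n X v = (\<Sum>i<n. \<Sum>j<n. v i * Poly_Mapping.lookup X (i, j) * v j)"

lemma linear_quad_form: "linear (\<lambda>X. quad_form n X v)"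
  by (rule linearI)
     (auto simp: quad_form_def lookup_add sum.distrib sum_distrib_left algebra_simps)

text \<open>
  Testing positive semidefiniteness on vectors supported on two coordinates bounds each summand
  \<open>y i * M i j * y j\<close> by the mean of \<open>M i i\<close> and \<open>M j j\<close>; summing over all pairs gives \<open>n\<close> times the trace.
\<close>
lemma quad_form_le_dimension:
  assumes M: "M \<in> spectraplex n" and y: "y \<in> cube n"
  shows "quad_form n M y \<le> n"
proof -
  let ?M = "\<lambda>i j. Poly_Mapping.lookup M (i, j)"
  have psd: "0 \<le> quad_form n M v" for v
    using M by (auto simp: spectraplex_def psd_def quad_form_def)
  have sym: "?M i j = ?M j i" for i j
    using M by (auto simp: spectraplex_def sym_mats_def)
  have le: "y i * ?M i j * y j \<le> (?M i i + ?M j j) / 2" if ij: "i < n" "j < n" for i j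
  proof -
    \<comment> \<open>The vector \<open>y i * e\<^sub>i - y j * e\<^sub>j\<close>, which is \<open>0\<close> for \<open>i = j\<close>.\<close>
    define v where "v k = (if k = i then y i else 0) - (if k = j then y j else 0)" for k
    have expand: "(\<Sum>l<n. w l * v l) = w i * y i - w j * y j" for w
    proof -
      have "w l * v l = (if l = i then w i * y i else 0) - (if l = j then w j * y j else 0)" for l
        by (simp add: v_def right_diff_distrib)
      then show ?thesis
        using ij by (simp add: sum_subtractf)
    qed
    have "quad_form n M v = (\<Sum>k<n. (?M k i * y i - ?M k j * y j) * v k)"
      unfolding quad_form_def
    proof (intro sum.cong refl)
      fix k
      have "(\<Sum>l<n. v k * ?M k l * v l) = v k * (\<Sum>l<n. ?M k l * v l)"
        by (simp add: sum_distrib_left mult.assoc)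
      then show "(\<Sum>l<n. v k * ?M k l * v l) = (?M k i * y i - ?M k j * y j) * v k"
        unfolding expand by (simp add: mult.commute)
    qed
    also have "\<dots> = (?M i i * y i - ?M i j * y j) * y i - (?M j i * y i - ?M j j * y j) * y j"
      by (rule expand)
    also have "\<dots> = ?M i i * (y i * y i) + ?M j j * (y j * y j) - 2 * (y i * ?M i j * y j)"
      unfolding sym[of j i] by (simp add: algebra_simps)
    also have "\<dots> = ?M i i + ?M j j - 2 * (y i * ?M i j * y j)"
      using cube_square[OF y] ij by simp
    finally show ?thesis
      using psd[of v] by simp
  qed
  have "quad_form n M y \<le> (\<Sum>i<n. \<Sum>j<n. (?M i i + ?M j j) / 2)"
    unfolding quad_form_def using le by (intro sum_mono) auto
  also have "\<dots> = n * mat_trace n M"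
    by (simp add: mat_trace_def add_divide_distrib sum.distrib flip: sum_divide_distrib sum_distrib_left)
  finally show ?thesis
    using M by (simp add: spectraplex_def)
qed

text \<open>
  The matrix \<open>x x\<^sup>T / n\<close>.
\<close>
definition cut_matrix :: "nat \<Rightarrow> (nat \<Rightarrow> real) \<Rightarrow> rmat" where
  "cut_matrix n x = Abs_poly_mapping (\<lambda>(i, j). if i < n \<and> j < n then x i * x j / n else 0)"

lemma lookup_cut_matrix:
  "Poly_Mapping.lookup (cut_matrix n x) (i, j) = (if i < n \<and> j < n then x i * x j / n else 0)"
proof -
  have "finite {z. (case z of (i, j) \<Rightarrow> if i < n \<and> j < n then x i * x j / n else 0) \<noteq> 0}"
    by (rule finite_subset[of _ "{..<n} \<times> {..<n}"]) (auto split: if_splits)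
  then show ?thesis
    by (simp add: cut_matrix_def)
qed

lemma quad_form_cut_matrix: "quad_form n (cut_matrix n x) y = (\<Sum>p<n. x p * y p)\<^sup>2 / n"
  by (simp add: quad_form_def lookup_cut_matrix power2_eq_square sum_product sum_divide_distrib mult_ac)

lemma cut_matrix_in_spectraplex:
  assumes n: "0 < n" and x: "x \<in> cube n"
  shows "cut_matrix n x \<in> spectraplex n"
proof -
  have "0 \<le> quad_form n (cut_matrix n x) v" for v
    by (simp add: quad_form_cut_matrix)
  then have "psd n (cut_matrix n x)"
    by (simp add: psd_def quad_form_def)
  moreover have "mat_trace n (cut_matrix n x) = 1"
    using n x by (simp add: mat_trace_def lookup_cut_matrix cube_square)
  moreover have "cut_matrix n x \<in> sym_mats n"
    by (auto simp: sym_mats_def in_keys_iff lookup_cut_matrix split: if_splits)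
  ultimately show ?thesis
    by (simp add: spectraplex_def)
qed

lemma two_cut_matrices:
  assumes "2 \<le> n"
  obtains x y where "x \<in> cube n" "y \<in> cube n" "cut_matrix n x \<noteq> cut_matrix n y"
proof
  let ?x = "\<lambda>i. if i < n then 1 else undefined :: real"
  let ?y = "\<lambda>i. if i = 0 then - 1 else if i < n then 1 else undefined :: real"
  show "?x \<in> cube n" "?y \<in> cube n"
    using assms by (auto simp: cube_def PiE_iff extensional_def)
  have "Poly_Mapping.lookup (cut_matrix n ?x) (0, 1) \<noteq> Poly_Mapping.lookup (cut_matrix n ?y) (0, 1)"
    using assms by (simp add: lookup_cut_matrix)
  then show "cut_matrix n ?x \<noteq> cut_matrix n ?y"
    by metis
qed

locale spectraplex_approximation =
  fixes \<epsilon> :: real and n :: nat and A :: rmat and P :: "rmat set"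
  assumes eps: "0 < \<epsilon>" "\<epsilon> < 1" and n: "2 \<le> n" and trace_A: "mat_trace n A = 1"
    and polytope_P: "polytope P"
    and inner: "dilate (1 - \<epsilon>) (translate_by (spectraplex n) A) \<subseteq> P"
    and outer: "P \<subseteq> translate_by (spectraplex n) A"
begin

lemma scaled_cut_matrix_in_P:
  "x \<in> cube n \<Longrightarrow> (1 - \<epsilon>) *\<^sub>R (cut_matrix n x - A) \<in> P"
  using inner n cut_matrix_in_spectraplex[of n x]
  by (fastforce simp: dilate_def translate_by_def)

lemma two_le_extension_complexity: "2 \<le> extension_complexity P"
proof -
  obtain x y where "x \<in> cube n" "y \<in> cube n" "cut_matrix n x \<noteq> cut_matrix n y"
    using two_cut_matrices[OF n] .
  moreover obtain Q and f :: "(nat, real) poly_mapping \<Rightarrow> rmat"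
    where "polytope Q" "card (facets Q) = extension_complexity P" "linear f" "P = f ` Q"
    using extension_complexity_attained[OF polytope_P] .
  ultimately show ?thesis
    using two_le_card_facets[of Q f "(1 - \<epsilon>) *\<^sub>R (cut_matrix n x - A)" "(1 - \<epsilon>) *\<^sub>R (cut_matrix n y - A)"]
      scaled_cut_matrix_in_P eps by auto
qed

text \<open>
  The slack matrix is evaluated at preimages \<open>u x\<close> of the scaled points. The facets of \<open>Q\<close> index the
  terms of its factorization, and \<open>None\<close> indexes the additional constant term.
\<close>
lemma few_facets_imp_small_dimension:
  assumes m: "0 < m" and few: "(extension_complexity P + 1) * n \<le> exp (2 * real m)"
  shows "(1 - \<epsilon>) * (real n - 1) \<le> 8 * exp 1 * (real m)\<^sup>2"
proof -
  obtain Q and f :: "(nat, real) poly_mapping \<Rightarrow> rmat"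
    where Q: "polytope Q" "card (facets Q) = extension_complexity P" and f: "linear f" and P: "P = f ` Q"
    using extension_complexity_attained[OF polytope_P] .
  have fin: "finite (facets Q)"
    using Q(1) finite_facets by (auto simp: polytope_def)
  have "\<forall>x\<in>cube n. \<exists>u. u \<in> Q \<and> f u = (1 - \<epsilon>) *\<^sub>R (cut_matrix n x - A)"
    using scaled_cut_matrix_in_P unfolding P by (metis imageE)
  then obtain u where u: "\<And>x. x \<in> cube n \<Longrightarrow> u x \<in> Q"
    "\<And>x. x \<in> cube n \<Longrightarrow> f (u x) = (1 - \<epsilon>) *\<^sub>R (cut_matrix n x - A)"
    by metis
  have "Q \<noteq> {}"
    using u(1) cube_nonempty by blast
  define g where "g y w = quad_form n (f w) y + quad_form n A y" for y w
  have g_eq: "g y w = quad_form n (f w + A) y" for y w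
    using linear_add[OF linear_quad_form] by (simp add: g_def)
  have mem: "f w + A \<in> spectraplex n" if "w \<in> Q" for w
    using outer that unfolding P translate_by_def by force
  have aff: "affine_functional (g y)" for y
    unfolding g_def using linear_compose[OF f linear_quad_form[of n y]]
    by (intro affine_functional_linear_add) (simp add: o_def)
  have nn: "0 \<le> g y w" if "w \<in> Q" for y w
    using mem[OF that] by (simp add: g_eq spectraplex_def psd_def quad_form_def)
  have "\<exists>\<mu> c. (\<forall>F. 0 \<le> \<mu> F) \<and> 0 \<le> c \<and>
      (\<forall>w\<in>Q. g y w = (\<Sum>F\<in>facets Q. \<mu> F * facet_functional Q F w) + c)" for y
    using nonneg_functional_facet_combination[OF Q(1) \<open>Q \<noteq> {}\<close> aff nn] by metis
  then obtain \<mu> c where \<mu>: "\<And>y F. 0 \<le> \<mu> y F" "\<And>y. 0 \<le> c y"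
    "\<And>y w. w \<in> Q \<Longrightarrow> g y w = (\<Sum>F\<in>facets Q. \<mu> y F * facet_functional Q F w) + c y"
    by metis
  define I where "I = insert None (Some ` facets Q)"
  define a where "a i x = (case i of None \<Rightarrow> 1 | Some F \<Rightarrow> facet_functional Q F (u x))" for i x
  define b where "b i y = (case i of None \<Rightarrow> c y | Some F \<Rightarrow> \<mu> y F)" for i y
  have card_I: "card I = extension_complexity P + 1"
    using fin Q(2) by (simp add: I_def card_image)
  have ab: "(\<Sum>i\<in>I. a i x * b i y) = g y (u x)" if "x \<in> cube n" for x y
    using fin \<mu>(3)[OF u(1)[OF that], of y]
    by (simp add: I_def a_def b_def sum.reindex mult.commute)
  have g_u: "g y (u x) = (1 - \<epsilon>) / n * (\<Sum>p<n. x p * y p)\<^sup>2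
      + \<epsilon> * (\<Sum>p<n. \<Sum>q<n. y p * Poly_Mapping.lookup A (p, q) * y q)" if x: "x \<in> cube n" for x y
  proof -
    have "quad_form n (f (u x)) y = (1 - \<epsilon>) * (quad_form n (cut_matrix n x) y - quad_form n A y)"
      unfolding u(2)[OF x]
      using linear_scale[OF linear_quad_form[of n y]] linear_diff[OF linear_quad_form[of n y]] by simp
    then have "g y (u x) = (1 - \<epsilon>) * quad_form n (cut_matrix n x) y + \<epsilon> * quad_form n A y"
      by (simp add: g_def algebra_simps)
    then show ?thesis
      by (simp only: quad_form_cut_matrix) (simp add: quad_form_def)
  qed
  interpret cube_slack_factorization n "(1 - \<epsilon>) / n" \<epsilon> "\<lambda>p q. Poly_Mapping.lookup A (p, q)" I a b
  proof
    show "(1 - \<epsilon>) / n * n + \<epsilon> = 1"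
      using n by simp
    show "(\<Sum>p<n. Poly_Mapping.lookup A (p, p)) = 1"
      using trace_A by (simp add: mat_trace_def)
    show "0 \<le> a i x" if "i \<in> I" "x \<in> cube n" for i x
      using u(1)[OF that(2)] by (auto simp: a_def facet_functional_nonneg split: option.split)
    show "0 \<le> b i x" if "i \<in> I" "x \<in> cube n" for i x
      using \<mu> by (auto simp: b_def split: option.split)
    fix x y assume xy: "x \<in> cube n" "y \<in> cube n"
    show "(\<Sum>i\<in>I. a i x * b i y) \<le> n"
      unfolding ab[OF xy(1)] g_eq using xy mem u(1) by (intro quad_form_le_dimension) auto
    show "(\<Sum>i\<in>I. a i x * b i y) = (1 - \<epsilon>) / n * (\<Sum>p<n. x p * y p)\<^sup>2
      + \<epsilon> * (\<Sum>p<n. \<Sum>q<n. y p * Poly_Mapping.lookup A (p, q) * y q)"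
      unfolding ab[OF xy(1)] by (rule g_u[OF xy(1)])
  qed (use n fin in \<open>auto simp: I_def\<close>)
  have "(1 - \<epsilon>) / n * (real n * (real n - 1)) \<le> 8 * exp 1 * (real m)\<^sup>2"
    using few by (intro few_terms_imp_small_dimension[OF m]) (simp add: card_I)
  then show ?thesis
    using n by simp
qed

text \<open>
  Let \<open>m\<close> be the largest integer below \<open>s * sqrt n\<close>. If \<open>e\<^sup>2\<^sup>m\<close> were at least the right-hand side,
  \<open>few_facets_imp_small_dimension\<close> together with \<open>8 * exp 1 \<le> 24\<close> and \<open>n \<le> 2 * (n - 1)\<close> would give
  \<open>(1 - \<epsilon>) * n \<le> 48 * m\<^sup>2\<close>, which the choice of \<open>s\<close> excludes.
\<close>
lemma extension_complexity_ge_exp: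
  defines "s \<equiv> sqrt ((1 - \<epsilon>) / 48)"
  shows "exp (2 * (s * sqrt n - 1)) \<le> (extension_complexity P + 1) * n"
proof (cases "s * sqrt n \<le> 1")
  case True
  then have "exp (2 * (s * sqrt n - 1)) \<le> exp 0"
    by (subst exp_le_cancel_iff) simp
  also have "\<dots> \<le> (extension_complexity P + 1) * n"
  proof -
    have "1 \<le> (extension_complexity P + 1) * n"
      using n by simp
    then have "real 1 \<le> real ((extension_complexity P + 1) * n)"
      by (rule of_nat_mono)
    then show ?thesis by simp
  qed
  finally show ?thesis by simp
next
  case False
  define m where "m = nat (\<lceil>s * sqrt n\<rceil> - 1)"
  have m: "0 < m" "real m < s * sqrt n" "s * sqrt n - 1 \<le> real m"
    using False by (auto simp: m_def) linarith+
  have "(real m)\<^sup>2 < (s * sqrt n)\<^sup>2"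
    using m by (intro power_strict_mono) auto
  also have "\<dots> = (1 - \<epsilon>) / 48 * n"
    using eps by (simp add: s_def power_mult_distrib)
  finally have "48 * (real m)\<^sup>2 < (1 - \<epsilon>) * n"
    by simp
  also have "\<dots> \<le> (1 - \<epsilon>) * (2 * (real n - 1))"
    using n eps by (intro mult_left_mono) auto
  also have "\<dots> = 2 * ((1 - \<epsilon>) * (real n - 1))"
    by simp
  finally have big: "24 * (real m)\<^sup>2 < (1 - \<epsilon>) * (real n - 1)"
    by linarith
  have "8 * exp 1 * (real m)\<^sup>2 \<le> 24 * (real m)\<^sup>2"
    using exp_le by (intro mult_right_mono) auto
  then have "\<not> (extension_complexity P + 1) * n \<le> exp (2 * real m)"
    using few_facets_imp_small_dimension[OF m(1)] big by linarith
  moreover have "exp (2 * (s * sqrt n - 1)) \<le> exp (2 * real m)"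
    using m(3) by simp
  ultimately show ?thesis by linarith
qed

end

theorem theorem1:
  fixes \<epsilon> :: real
  assumes "0 < \<epsilon>" and "\<epsilon> < 1"
  shows "\<exists>c>0. \<forall>n\<ge>2. \<forall>A\<in>sym_mats n. mat_trace n A = 1 \<longrightarrow>
           (\<forall>P. polytope P \<and>
                dilate (1 - \<epsilon>) (translate_by (spectraplex n) A) \<subseteq> P \<and>
                P \<subseteq> translate_by (spectraplex n) A \<longrightarrow>
                exp (c * sqrt (real n)) \<le> real (extension_complexity P))"
proof -
  define s where "s = sqrt ((1 - \<epsilon>) / 48)"
  define L where "L = ln (2 / s)"
  define \<theta> where "\<theta> = ln 2 / (L + ln 2)"
  have s: "0 < s" "s < 1"
    using assms by (auto simp: s_def)
  then have L: "0 < L"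
    by (simp add: L_def)
  then have "0 < L + ln 2"
    by (simp add: add_pos_pos)
  then have \<theta>: "0 < \<theta>" "\<theta> < 1" "\<theta> * (L + ln 2) = ln 2"
    using L by (auto simp: \<theta>_def)
  show ?thesis
  proof (intro exI[of _ "\<theta> * s / 2"] conjI allI ballI impI)
    show "0 < \<theta> * s / 2"
      using \<theta> s by simp
    fix n A P assume n: "(2::nat) \<le> n" and "A \<in> sym_mats n" and A: "mat_trace n A = 1"
      and P: "polytope P \<and> dilate (1 - \<epsilon>) (translate_by (spectraplex n) A) \<subseteq> P \<and>
                P \<subseteq> translate_by (spectraplex n) A"
    interpret spectraplex_approximation \<epsilon> n A P
      using assms n A P by unfold_locales auto
    define k where "k = real (extension_complexity P)"
    define t where "t = sqrt n"
    have k: "2 \<le> k"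
      using two_le_extension_complexity by (simp add: k_def)
    have t: "0 < t" "real n = t ^ 2"
      using n by (auto simp: t_def)
    \<comment> \<open>Replacing the factor \<open>k + 1\<close> by \<open>k\<^sup>2\<close>, which is no smaller for \<open>k \<ge> 2\<close>,
      and writing \<open>n = t\<^sup>2\<close> makes the right-hand side a square.\<close>
    have "exp (2 * (s * t - 1)) \<le> (k + 1) * n"
      using extension_complexity_ge_exp by (simp add: s_def t_def k_def algebra_simps)
    also have "\<dots> \<le> (k * k) * n"
    proof (rule mult_right_mono)
      have "k + 1 \<le> 2 * k" using k by simp
      also have "\<dots> \<le> k * k" using k by (intro mult_right_mono) auto
      finally show "k + 1 \<le> k * k" .
    qed simp
    finally have "exp (2 * (s * t - 1)) \<le> (k * t) ^ 2"
      by (simp add: t(2) power2_eq_square mult_ac)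
    then have "2 * (s * t - 1) \<le> ln ((k * t) ^ 2)"
      using k t(1) by (subst ln_ge_iff) auto
    also have "\<dots> = 2 * (ln k + ln t)"
      using k t by (simp add: ln_realpow ln_mult)
    finally have "s * t - 1 - ln t \<le> ln k"
      by simp
    moreover have "ln t \<le> s * t / 2 - 1 + L"
    proof -
      have "ln (s * t / 2) \<le> s * t / 2 - 1"
        using s t by (intro ln_le_minus_one) auto
      then show ?thesis
        using s t by (simp add: L_def ln_div ln_mult)
    qed
    ultimately have large: "s * t / 2 - L \<le> ln k"
      by linarith
    \<comment> \<open>\<open>ln k\<close> is at least \<open>s * t / 2 - L\<close> and at least \<open>ln 2\<close>. The weight \<open>\<theta>\<close> is such that in the
      corresponding average of the two bounds the constants \<open>L\<close> and \<open>ln 2\<close> cancel.\<close>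
    have "\<theta> * s / 2 * t = \<theta> * (s * t / 2 - L) + (1 - \<theta>) * ln 2"
      using \<theta>(3) by (simp add: algebra_simps)
    also have "\<dots> \<le> \<theta> * ln k + (1 - \<theta>) * ln k"
      using large \<theta> k by (intro add_mono mult_left_mono) auto
    finally have "\<theta> * s / 2 * t \<le> ln k"
      by (simp add: algebra_simps)
    then have "exp (\<theta> * s / 2 * t) \<le> k"
      using k by (subst (asm) ln_ge_iff) auto
    then show "exp (\<theta> * s / 2 * sqrt (real n)) \<le> real (extension_complexity P)"
      by (simp add: t_def k_def)
  qed
qed

end
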